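(* Let $p\in(\vec{p}_c,1)$ and let $G$ be the random oriented graph formed by the right-most infinite open paths $\gamma_u$, $u\in\mathcal{K}$, of oriented percolation with parameter $p$ on $\mathcal{L}$. Then, almost surely: (i) $G$ has a unique connected component; (ii) $G$ has finite branches, i.e. $D(u,G)$ is finite for all $u\in\mathcal{K}$; (iii) each vertex of $G$ has an ancestor with a younger sister.
   Context: Oriented percolation. Let $\mathcal{L}=\{(m,n)\in\mathbb{Z}^2: m+n \text{ is even}\}$, with oriented edges from $(m,n)$ to $(m+1,n+1)$ and to $(m-1,n+1)$. Each edge is independently open with probability $p$ and closed with probability $1-p$; $\mathbb{P}_p$ is the product measure. For $u,v\in\mathcal{L}$ write $u\to v$ if there is a (possibly trivial) oriented path of open edges from $u$ to $v$. Let $C_u=\{v\in\mathcal{L}:u\to v\}$, $\theta(p)=\mathbb{P}_p(|C_{(0,0)}|=\infty)$, and $\vec{p}_c=\sup\{p:\theta(p)=0\}$; it is known that $0<\vec{p}_c<1$. A vertex $u$ is a percolation point if $|C_u|=\infty$, and $\mathcal{K}=\{u\in\mathcal{L}:|C_u|=\infty\}$. Right-most paths. For $(x,y)\in\mathcal{K}$, the right-most infinite open path $\gamma_{(x,y)}$ is the infinite oriented open path with vertices $v_0=(x,y),v_1,v_2,\dots$, $v_n=(x_n,y_n)$ (each edge from $v_{n-1}$ to $v_n$ being an open oriented edge), such that for every $n\ge 1$ there is no integer $k\ge1$ with $(x,y)\to(x_n+k,y_n)$ and $(x_n+k,y_n)\in\mathcal{K}$. The graph $G$. $G$ is the union of the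 paths $\gamma_u$, $u\in\mathcal{K}$: its vertex set is $\mathcal{K}$ and its edges are the (open) edges belonging to some $\gamma_u$, $u\in\mathcal{K}$. Each vertex $u$ of $G$ is the starting point of exactly one edge of $G$; the other endpoint of that edge is the mother $M(u)$ of $u$. If $M(v)=u$ then $v$ is a daughter of $u$; each vertex $u=(m,n)$ has at most two daughters, which lie among $(m-1,n-1)$ and $(m+1,n-1)$. If $u$ has two daughters they are sisters; $(m-1,n-1)$ is the older sister and $(m+1,n-1)$ is the younger sister. Set $M^0(u)=u$ and $M^n(u)=M(M^{n-1}(u))$ for $n\ge1$; $M^n(u)$ is the $n$th ancestor of $u$. The branch of $u$ is $D(u,G)=\bigcup_{n\ge0}\{v\in\mathcal{K}:M^n(v)=u\}$. Two vertices $u,v\in\mathcal{K}$ are connected if $M^n(u)=M^m(v)$ for some integers $n,m\ge0$; this is an equivalence relation on $\mathcal{K}$ whose classes are the connected components of $G$. *)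

theory Defs
  imports "HOL-Probability.Probability"
begin

type_synonym vertex = "int \<times> int"
type_synonym edge = "vertex \<times> vertex"

section \<open>Oriented percolation\<close>

definition lattice :: "vertex set" where
  "lattice = {(m, n). even (m + n)}"

definition lattice_edges :: "edge set" where
  "lattice_edges = {((m, n), v) | m n v. (m, n) \<in> lattice \<and>
     (v = (m + 1, n + 1) \<or> v = (m - 1, n + 1))}"

text \<open>A configuration assigns \<^term>\<open>True\<close> to the open edges. It is only meaningful on
  \<^term>\<open>lattice_edges\<close>.\<close>

definition percolation :: "real \<Rightarrow> (edge \<Rightarrow> bool) measure" where
  "percolation p = (\<Pi>\<^sub>M e\<in>lattice_edges. measure_pmf (bernoulli_pmf p))"

definition open_edges :: "(edge \<Rightarrow> bool) \<Rightarrow> edge set" where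
  "open_edges \<omega> = {e \<in> lattice_edges. \<omega> e}"

definition reaches :: "(edge \<Rightarrow> bool) \<Rightarrow> vertex \<Rightarrow> vertex \<Rightarrow> bool" where
  "reaches \<omega> u v \<longleftrightarrow> (u, v) \<in> (open_edges \<omega>)\<^sup>*"

definition cluster :: "(edge \<Rightarrow> bool) \<Rightarrow> vertex \<Rightarrow> vertex set" where
  "cluster \<omega> u = {v \<in> lattice. reaches \<omega> u v}"

definition theta :: "real \<Rightarrow> real" where
  "theta p = measure (percolation p) {\<omega> \<in> space (percolation p). infinite (cluster \<omega> (0, 0))}"

text \<open>The restriction to \<open>[0, 1]\<close> matters, because \<^const>\<open>bernoulli_pmf\<close> clips its parameter.\<close>

definition p_crit :: real where
  "p_crit = Sup {p \<in> {0..1}. theta p = 0}"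

definition perc_points :: "(edge \<Rightarrow> bool) \<Rightarrow> vertex set" where
  "perc_points \<omega> = {u \<in> lattice. infinite (cluster \<omega> u)}"

section \<open>Right-most infinite open paths and the graph they form\<close>

definition rightmost_path :: "(edge \<Rightarrow> bool) \<Rightarrow> vertex \<Rightarrow> (nat \<Rightarrow> vertex) \<Rightarrow> bool" where
  "rightmost_path \<omega> u v \<longleftrightarrow>
     v 0 = u \<and>
     (\<forall>n. (v n, v (Suc n)) \<in> open_edges \<omega>) \<and>
     (\<forall>n\<ge>1. \<not> (\<exists>k\<ge>1. reaches \<omega> u (fst (v n) + k, snd (v n)) \<and>
                     (fst (v n) + k, snd (v n)) \<in> perc_points \<omega>))"

text \<open>Only meaningful for \<open>u \<in> perc_points \<omega>\<close>; see \<open>rightmost_path_ex1\<close> below.\<close>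

definition gam :: "(edge \<Rightarrow> bool) \<Rightarrow> vertex \<Rightarrow> nat \<Rightarrow> vertex" where
  "gam \<omega> u = (THE v. rightmost_path \<omega> u v)"

text \<open>The vertex set of the graph is \<^term>\<open>perc_points \<omega>\<close>.\<close>

definition graph_edges :: "(edge \<Rightarrow> bool) \<Rightarrow> edge set" where
  "graph_edges \<omega> = (\<Union>u\<in>perc_points \<omega>. {(gam \<omega> u n, gam \<omega> u (Suc n)) | n. True})"

text \<open>Only meaningful for \<open>u \<in> perc_points \<omega>\<close>; see \<open>graph_edge_ex1\<close> below.\<close>

definition mother :: "(edge \<Rightarrow> bool) \<Rightarrow> vertex \<Rightarrow> vertex" where
  "mother \<omega> u = (THE w. (u, w) \<in> graph_edges \<omega>)"

definition daughter :: "(edge \<Rightarrow> bool) \<Rightarrow> vertex \<Rightarrow> vertex \<Rightarrow> bool" where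
  "daughter \<omega> v u \<longleftrightarrow> v \<in> perc_points \<omega> \<and> u \<in> perc_points \<omega> \<and> mother \<omega> v = u"

text \<open>\<open>younger_sister \<omega> s v\<close> says that \<open>s\<close> is the younger sister of \<open>v\<close>.\<close>

definition younger_sister :: "(edge \<Rightarrow> bool) \<Rightarrow> vertex \<Rightarrow> vertex \<Rightarrow> bool" where
  "younger_sister \<omega> s v \<longleftrightarrow>
     (\<exists>m n. v = (m - 1, n - 1) \<and> s = (m + 1, n - 1) \<and>
            daughter \<omega> v (m, n) \<and> daughter \<omega> s (m, n))"

definition branch :: "(edge \<Rightarrow> bool) \<Rightarrow> vertex \<Rightarrow> vertex set" where
  "branch \<omega> u = (\<Union>n. {v \<in> perc_points \<omega>. (mother \<omega> ^^ n) v = u})"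

definition connected_rel :: "(edge \<Rightarrow> bool) \<Rightarrow> (vertex \<times> vertex) set" where
  "connected_rel \<omega> = {(u, v). u \<in> perc_points \<omega> \<and> v \<in> perc_points \<omega> \<and>
     (\<exists>n m. (mother \<omega> ^^ n) u = (mother \<omega> ^^ m) v)}"

definition graph_components :: "(edge \<Rightarrow> bool) \<Rightarrow> vertex set set" where
  "graph_components \<omega> = perc_points \<omega> // connected_rel \<omega>"

section \<open>Well-definedness\<close>

text \<open>The event in the definition of \<^const>\<open>theta\<close> is measurable.\<close>

lemma measurable_open_edges:
  "Measurable.pred (percolation p) (\<lambda>\<omega>. e \<in> open_edges \<omega>)"
proof (cases "e \<in> lattice_edges")
  case True
  have "(\<lambda>\<omega>. \<omega> e) \<in> measurable (percolation p) (measure_pmf (bernoulli_pmf p))"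
    unfolding percolation_def by (rule measurable_component_singleton[OF True])
  then have "(\<lambda>\<omega>. \<omega> e) \<in> measurable (percolation p) (count_space UNIV)"
    by (simp cong: measurable_cong_sets)
  then show ?thesis using True by (simp add: open_edges_def)
qed (simp add: open_edges_def)

lemma measurable_reaches:
  "Measurable.pred (percolation p) (\<lambda>\<omega>. reaches \<omega> u v)"
proof -
  have "Measurable.pred (percolation p) (\<lambda>\<omega>. (u, v) \<in> open_edges \<omega> ^^ n)" for n
  proof (induction n arbitrary: v)
    case (Suc n)
    have "Measurable.pred (percolation p)
            (\<lambda>\<omega>. \<exists>y. (u, y) \<in> open_edges \<omega> ^^ n \<and> (y, v) \<in> open_edges \<omega>)"
      by (intro pred_intros_countable pred_intros_logic Suc measurable_open_edges)
    then show ?case by (simp add: relcomp_unfold)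
  qed simp
  then have "Measurable.pred (percolation p) (\<lambda>\<omega>. \<exists>n. (u, v) \<in> open_edges \<omega> ^^ n)"
    by (intro pred_intros_countable)
  then show ?thesis by (simp add: reaches_def rtrancl_power)
qed

lemma measurable_infinite_cluster:
  "{\<omega> \<in> space (percolation p). infinite (cluster \<omega> u)} \<in> sets (percolation p)"
proof -
  have inf: "infinite S \<longleftrightarrow> (\<forall>xs. \<exists>v. v \<notin> set xs \<and> v \<in> S)" for S :: "vertex set"
    by (metis List.finite_set ex_new_if_finite finite_list finite_subset subsetI)
  have "Measurable.pred (percolation p)
          (\<lambda>\<omega>. \<forall>xs. \<exists>v. v \<notin> set xs \<and> v \<in> lattice \<and> reaches \<omega> u v)"
    by (intro pred_intros_countable pred_intros_logic measurable_reaches) simp_all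
  then show ?thesis
    unfolding inf cluster_def by (simp add: pred_def)
qed

text \<open>Every percolation point has exactly one right-most infinite open path and exactly one
  outgoing edge. Both follow from the greedy description: step right whenever the right edge
  is open and leads to a percolation point, and left otherwise.\<close>

definition greedy_step :: "(edge \<Rightarrow> bool) \<Rightarrow> vertex \<Rightarrow> vertex" where
  "greedy_step \<omega> u =
     (let r = (fst u + 1, snd u + 1); l = (fst u - 1, snd u + 1)
      in if (u, r) \<in> open_edges \<omega> \<and> r \<in> perc_points \<omega> then r else l)"

lemma open_edges_cases:
  assumes "(u, v) \<in> open_edges \<omega>"
  shows "u \<in> lattice \<and> v \<in> lattice \<and> (v = (fst u + 1, snd u + 1) \<or> v = (fst u - 1, snd u + 1))"
  using assms by (auto simp: open_edges_def lattice_edges_def lattice_def)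

lemma cluster_unfold:
  assumes "u \<in> lattice"
  shows "cluster \<omega> u = insert u (\<Union>v\<in>{v. (u, v) \<in> open_edges \<omega>}. cluster \<omega> v)"
  using assms unfolding cluster_def reaches_def
  by (auto elim: converse_rtranclE intro: converse_rtrancl_into_rtrancl)

lemma cluster_mono: "reaches \<omega> u v \<Longrightarrow> cluster \<omega> v \<subseteq> cluster \<omega> u"
  unfolding cluster_def reaches_def by auto

lemma greedy_step_open:
  assumes "u \<in> perc_points \<omega>"
  shows "(u, greedy_step \<omega> u) \<in> open_edges \<omega>" "greedy_step \<omega> u \<in> perc_points \<omega>"
proof -
  have u: "u \<in> lattice" "infinite (cluster \<omega> u)" using assms by (auto simp: perc_points_def)
  let ?S = "{v. (u, v) \<in> open_edges \<omega>}"
  have "?S \<subseteq> {(fst u + 1, snd u + 1), (fst u - 1, snd u + 1)}"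
    using open_edges_cases by blast
  then have "finite ?S" by (rule finite_subset) simp
  then obtain v where v: "(u, v) \<in> open_edges \<omega>" "infinite (cluster \<omega> v)"
    using u cluster_unfold[OF u(1), of \<omega>] by auto
  have c: "v \<in> lattice" "v = (fst u + 1, snd u + 1) \<or> v = (fst u - 1, snd u + 1)"
    using open_edges_cases[OF v(1)] by auto
  have "v \<in> perc_points \<omega>" using c v by (simp add: perc_points_def)
  then show "(u, greedy_step \<omega> u) \<in> open_edges \<omega>" "greedy_step \<omega> u \<in> perc_points \<omega>"
    using c v by (auto simp: greedy_step_def Let_def)
qed

lemma reaches_perc_points:
  assumes "reaches \<omega> u v" "v \<in> perc_points \<omega>" shows "u \<in> perc_points \<omega>"
proof -
  have "u \<in> lattice"
    using assms(1) unfolding reaches_def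
    by (cases rule: converse_rtranclE)
       (use assms(2) in \<open>auto dest: open_edges_cases simp: perc_points_def\<close>)
  then show ?thesis
    using assms cluster_mono[OF assms(1)] by (auto simp: perc_points_def dest: finite_subset)
qed

lemma greedy_orbit:
  assumes "u \<in> perc_points \<omega>"
  shows "(greedy_step \<omega> ^^ n) u \<in> perc_points \<omega>"
  by (induction n) (simp_all add: assms greedy_step_open)

lemma snd_greedy: "snd ((greedy_step \<omega> ^^ n) u) = snd u + int n"
  by (induction n) (auto simp: greedy_step_def Let_def)

lemma greedy_rightmost:
  assumes u: "u \<in> perc_points \<omega>"
    and w: "(u, w) \<in> open_edges \<omega> ^^ n" "w \<in> perc_points \<omega>"
  shows "snd w = snd u + int n \<and> fst w \<le> fst ((greedy_step \<omega> ^^ n) u)"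
  using w
proof (induction n arbitrary: w)
  case 0
  then show ?case by simp
next
  case (Suc n)
  let ?g = "(greedy_step \<omega> ^^ n) u"
  obtain y where y: "(u, y) \<in> open_edges \<omega> ^^ n" "(y, w) \<in> open_edges \<omega>"
    using Suc.prems(1) by auto
  have yp: "y \<in> perc_points \<omega>"
    using reaches_perc_points[of \<omega> y w] y(2) Suc.prems(2) by (auto simp: reaches_def)
  have IH: "snd y = snd u + int n" "fst y \<le> fst ?g" using Suc.IH[OF y(1) yp] by auto
  have gp: "?g \<in> perc_points \<omega>" using greedy_orbit[OF u] .
  have s: "snd ?g = snd y" using snd_greedy[of n \<omega> u] IH(1) by simp
  have wc: "w = (fst y + 1, snd y + 1) \<or> w = (fst y - 1, snd y + 1)"
    using open_edges_cases[OF y(2)] by auto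
  have par: "even (fst y + snd y)" "even (fst ?g + snd ?g)"
    using yp gp by (auto simp: perc_points_def lattice_def)
  have sg: "fst ?g - 1 \<le> fst (greedy_step \<omega> ?g)" by (simp add: greedy_step_def Let_def)
  show ?case
  proof (cases "fst y = fst ?g")
    case True
    then have "y = ?g" using s by (simp add: prod_eq_iff)
    then have "fst w \<le> fst (greedy_step \<omega> ?g)"
      using wc y(2) Suc.prems(2) by (auto simp: greedy_step_def Let_def)
    then show ?thesis using wc IH(1) by auto
  next
    case False
    have "even (fst ?g - fst y)" using par unfolding s by presburger
    moreover have "fst ?g - fst y > 0" using False IH(2) by linarith
    ultimately have "fst ?g - fst y \<ge> 2" by presburger
    then have "fst y + 2 \<le> fst ?g" by linarith
    then show ?thesis using wc IH(1) sg by auto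
  qed
qed

lemma path_reaches:
  assumes "\<And>n. (v n, v (Suc n)) \<in> open_edges \<omega>"
  shows "(v 0, v n) \<in> open_edges \<omega> ^^ n" "reaches \<omega> (v 0) (v n)"
proof -
  show *: "(v 0, v n) \<in> open_edges \<omega> ^^ n"
    unfolding relpow_fun_conv by (rule exI[of _ v]) (simp add: assms)
  show "reaches \<omega> (v 0) (v n)"
    unfolding reaches_def by (rule relpow_imp_rtrancl[OF *])
qed

lemma path_snd:
  assumes "\<And>n. (v n, v (Suc n)) \<in> open_edges \<omega>"
  shows "snd (v n) = snd (v 0) + int n"
proof (induction n)
  case (Suc n)
  then show ?case using open_edges_cases[OF assms[of n]] by auto
qed simp

lemma path_perc_points:
  assumes "\<And>n. (v n, v (Suc n)) \<in> open_edges \<omega>"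
  shows "v n \<in> perc_points \<omega>"
proof -
  have "v (n + k) \<in> cluster \<omega> (v n)" for k
    using path_reaches(2)[of "\<lambda>k. v (n + k)" \<omega> k] assms
      open_edges_cases[OF assms[of "n + k"]] by (auto simp: cluster_def)
  then have "range (\<lambda>k. v (n + k)) \<subseteq> cluster \<omega> (v n)" by auto
  moreover have "inj (\<lambda>k. v (n + k))"
  proof (rule injI)
    fix i j assume "v (n + i) = v (n + j)"
    then have "snd (v (n + i)) = snd (v (n + j))" by (rule arg_cong)
    then have "snd (v 0) + int (n + i) = snd (v 0) + int (n + j)"
      by (simp only: path_snd[of v \<omega> "n + i", OF assms] path_snd[of v \<omega> "n + j", OF assms])
    then show "i = j" by simp
  qed
  then have "infinite (range (\<lambda>k. v (n + k)))" by (rule range_inj_infinite)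
  ultimately have "infinite (cluster \<omega> (v n))" by (rule infinite_super)
  then show ?thesis using open_edges_cases[OF assms[of n]] by (auto simp: perc_points_def)
qed

lemma rightmost_path_greedy:
  assumes "u \<in> perc_points \<omega>"
  shows "rightmost_path \<omega> u (\<lambda>n. (greedy_step \<omega> ^^ n) u)"
  unfolding rightmost_path_def
proof (intro conjI allI impI notI)
  let ?g = "\<lambda>n. (greedy_step \<omega> ^^ n) u"
  show "(?g n, ?g (Suc n)) \<in> open_edges \<omega>" for n
    using greedy_step_open(1)[OF greedy_orbit[OF assms]] by simp
  fix n
  assume "\<exists>k\<ge>1. reaches \<omega> u (fst (?g n) + k, snd (?g n)) \<and>
                (fst (?g n) + k, snd (?g n)) \<in> perc_points \<omega>"
  then obtain k j where k: "k \<ge> 1" "(u, (fst (?g n) + k, snd (?g n))) \<in> open_edges \<omega> ^^ j"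
    "(fst (?g n) + k, snd (?g n)) \<in> perc_points \<omega>"
    by (auto simp: reaches_def rtrancl_power)
  then show False
    using greedy_rightmost[OF assms k(2,3)] snd_greedy[of n \<omega> u] by auto
qed simp

lemma rightmost_path_unique:
  assumes "rightmost_path \<omega> u v" "rightmost_path \<omega> u w"
  shows "v = w"
proof
  fix n
  have vw: "\<And>n. (v n, v (Suc n)) \<in> open_edges \<omega>" "\<And>n. (w n, w (Suc n)) \<in> open_edges \<omega>"
    "v 0 = u" "w 0 = u"
    using assms by (auto simp: rightmost_path_def)
  have s: "snd (v n) = snd (w n)" using path_snd[of v \<omega> n, OF vw(1)] path_snd[of w \<omega> n, OF vw(2)] vw(3,4) by simp
  have r: "reaches \<omega> u (v n)" "reaches \<omega> u (w n)"
    using path_reaches(2)[of v \<omega> n, OF vw(1)] path_reaches(2)[of w \<omega> n, OF vw(2)] vw(3,4) by simp_all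
  have le: "\<not> fst (f n) < fst b"
    if f: "rightmost_path \<omega> u f" and n: "n \<ge> 1" and b: "snd (f n) = snd b"
      "reaches \<omega> u b" "b \<in> perc_points \<omega>" for f b
  proof
    assume "fst (f n) < fst b"
    then have "fst b - fst (f n) \<ge> 1" "(fst (f n) + (fst b - fst (f n)), snd (f n)) = b"
      using b(1) by (auto simp: prod_eq_iff)
    then show False using f n b(2,3) unfolding rightmost_path_def by metis
  qed
  show "v n = w n"
  proof (cases "n = 0")
    case False
    then have "\<not> fst (v n) < fst (w n)" "\<not> fst (w n) < fst (v n)"
      using le[OF assms(1) _ s] le[OF assms(2) _ s[symmetric]] r
        path_perc_points[of v, OF vw(1)] path_perc_points[of w, OF vw(2)] by auto
    then show ?thesis using s by (simp add: prod_eq_iff)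
  qed (simp add: vw)
qed

lemma rightmost_path_ex1: "u \<in> perc_points \<omega> \<Longrightarrow> \<exists>!v. rightmost_path \<omega> u v"
  using rightmost_path_greedy rightmost_path_unique by blast

lemma gam_greedy:
  assumes "u \<in> perc_points \<omega>"
  shows "gam \<omega> u n = (greedy_step \<omega> ^^ n) u"
proof -
  have "gam \<omega> u = (\<lambda>n. (greedy_step \<omega> ^^ n) u)"
    unfolding gam_def
    by (rule the_equality)
       (auto intro: rightmost_path_greedy[OF assms] rightmost_path_unique[OF _ rightmost_path_greedy[OF assms]])
  then show ?thesis by simp
qed

lemma graph_edges_greedy: "graph_edges \<omega> = {(u, greedy_step \<omega> u) | u. u \<in> perc_points \<omega>}"
proof (intro set_eqI iffI)
  fix e assume "e \<in> graph_edges \<omega>"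
  then obtain u n where u: "u \<in> perc_points \<omega>" "e = (gam \<omega> u n, gam \<omega> u (Suc n))"
    unfolding graph_edges_def by blast
  then have "e = ((greedy_step \<omega> ^^ n) u, greedy_step \<omega> ((greedy_step \<omega> ^^ n) u))"
    by (simp add: gam_greedy)
  then show "e \<in> {(u, greedy_step \<omega> u) | u. u \<in> perc_points \<omega>}"
    using greedy_orbit[OF u(1)] by blast
next
  fix e assume "e \<in> {(u, greedy_step \<omega> u) | u. u \<in> perc_points \<omega>}"
  then obtain u where u: "u \<in> perc_points \<omega>" "e = (u, greedy_step \<omega> u)" by auto
  then have "e = (gam \<omega> u 0, gam \<omega> u (Suc 0))" by (simp add: gam_greedy)
  then show "e \<in> graph_edges \<omega>" using u(1) unfolding graph_edges_def by blast
qed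

lemma graph_edge_ex1: "u \<in> perc_points \<omega> \<Longrightarrow> \<exists>!w. (u, w) \<in> graph_edges \<omega>"
  unfolding graph_edges_greedy by blast

lemma mother_greedy: "u \<in> perc_points \<omega> \<Longrightarrow> mother \<omega> u = greedy_step \<omega> u"
  unfolding mother_def graph_edges_greedy by (rule the_equality) blast+

lemma mother_in: "u \<in> perc_points \<omega> \<Longrightarrow> mother \<omega> u \<in> perc_points \<omega>"
  by (simp add: mother_greedy greedy_step_open)

lemma equiv_connected_rel: "equiv (perc_points \<omega>) (connected_rel \<omega>)"
proof (rule equivI)
  show "connected_rel \<omega> \<subseteq> perc_points \<omega> \<times> perc_points \<omega>" by (auto simp: connected_rel_def)
  show "refl_on (perc_points \<omega>) (connected_rel \<omega>)" by (auto simp: refl_on_def connected_rel_def)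
  show "sym (connected_rel \<omega>)"
  proof (rule symI)
    fix x y assume "(x, y) \<in> connected_rel \<omega>"
    then obtain a b where h: "x \<in> perc_points \<omega>" "y \<in> perc_points \<omega>"
      "(mother \<omega> ^^ a) x = (mother \<omega> ^^ b) y"
      by (auto simp: connected_rel_def)
    show "(y, x) \<in> connected_rel \<omega>" using h(1,2) h(3)[symmetric]
      unfolding connected_rel_def by blast
  qed
  show "trans (connected_rel \<omega>)"
  proof (rule transI)
    fix x y z assume "(x, y) \<in> connected_rel \<omega>" "(y, z) \<in> connected_rel \<omega>"
    then obtain a b c d where
      h: "x \<in> perc_points \<omega>" "z \<in> perc_points \<omega>" "(mother \<omega> ^^ a) x = (mother \<omega> ^^ b) y"
        "(mother \<omega> ^^ c) y = (mother \<omega> ^^ d) z"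
      by (auto simp: connected_rel_def)
    have "(mother \<omega> ^^ (c + a)) x = (mother \<omega> ^^ (b + c)) y"
      unfolding add.commute[of b c] by (simp add: funpow_add h)
    also have "\<dots> = (mother \<omega> ^^ (b + d)) z" by (simp add: funpow_add h)
    finally show "(x, z) \<in> connected_rel \<omega>" using h unfolding connected_rel_def by blast
  qed
qed

end

theory Submission
  imports Defs
begin

text \<open>The proof rests on planarity, on the invariance of the measure under translations, on the
  independence of the edges below and above a level, and on counting.

  On percolation points the mother is the greedy step, which looks only at the configuration
  above the present level and preserves the left-right order on each level. So paths started
  on one level never cross, and once two of them meet they stay together. Two counting principles
  turn translation invariance into almost sure statements. If a translation-covariant property
  holds for at most \<open>c\<close> vertices of a finite set \<open>B\<close>, its probability at a vertex is at most
  \<open>c / |B|\<close> (\<open>covariant_card_bound\<close>). In particular, a property that holds for at most one vertex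
  on each level almost surely never holds (\<open>covariant_unique_on_levels\<close>).

  \<^item> No component has a lowest point. Select, in each component that has one, the left-most point of
    its lowest level. Selected points lie in different components, so their paths are disjoint; those
    that start in a box of side length of order \<open>N\<close> must leave through different points of the top,
    which leaves room for only order \<open>N\<close> of them among order \<open>N\<^sup>2\<close> vertices (\<open>AE_no_lowest\<close>).

  \<^item> There are at most two components. If three paths from one level never meet, then, independently
    of them, with positive probability all edges that enter the level between the outer two starting
    points are closed. The component of the middle path is then enclosed by the other two paths and
    cannot reach below its level, so it has a lowest point (\<open>AE_not_three_components\<close>).

  \<^item> There are not two components either, since the last point of the left one on a
    level would be a covariant choice of one vertex (\<open>AE_coalesce\<close>).

  \<^item> Call a vertex ancient if it has descendants in every generation. Each ancient vertex has one
    mother, which is ancient, and at least one ancient daughter. By mass transport the expected number of ancient daughters is one, so almost surely there are never two.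
    But two ancient vertices on a level coalesce, which would produce a vertex with two ancient
    daughters. So each level has at most one of them, and hence none (\<open>AE_no_ancient\<close>). A
    branch that is not finite would make its root ancient.

  \<^item> No percolation point is the right-most one on its level, again by uniqueness on the level. The
    path from a percolation point further to the right joins the given path from the right, and at
    the place where it does so it supplies the younger sister.

  Percolation points exist by Kolmogorov's zero-one law, because their existence does not depend on
  the edges below any given level.\<close>

section \<open>Ancestors and coalescence\<close>

abbreviation anc :: "(edge \<Rightarrow> bool) \<Rightarrow> nat \<Rightarrow> vertex \<Rightarrow> vertex" where
  "anc \<omega> n u \<equiv> (greedy_step \<omega> ^^ n) u"

text \<open>Only used for vertices on the same level, where equality of ancestors forces equal numbers of
  steps.\<close>

definition coalesce :: "(edge \<Rightarrow> bool) \<Rightarrow> vertex \<Rightarrow> vertex \<Rightarrow> bool" where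
  "coalesce \<omega> u v \<longleftrightarrow> (\<exists>n. anc \<omega> n u = anc \<omega> n v)"

lemma perc_points_lattice: "u \<in> perc_points \<omega> \<Longrightarrow> u \<in> lattice"
  by (simp add: perc_points_def)

lemma greedy_step_cases:
  "greedy_step \<omega> u = u + (1, 1) \<or> greedy_step \<omega> u = u + (-1, 1)"
  by (cases u) (auto simp: greedy_step_def Let_def)

lemma fst_anc_bound: "\<bar>fst (anc \<omega> n u) - fst u\<bar> \<le> int n"
proof (induction n)
  case (Suc n)
  then show ?case using greedy_step_cases[of \<omega> "anc \<omega> n u"] by auto
qed simp

lemma anc_add: "anc \<omega> n (anc \<omega> m u) = anc \<omega> (n + m) u"
  by (simp add: funpow_add)

lemma mother_pow:
  assumes "u \<in> perc_points \<omega>"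
  shows "(mother \<omega> ^^ n) u = anc \<omega> n u"
  by (induction n) (simp_all add: mother_greedy greedy_orbit assms)

text \<open>The parity of the lattice leaves a gap of two between neighbours on a level. As a step moves
  by one, paths may meet but cannot jump over each other; this is all that planarity is used for.\<close>

lemma lattice_same_level_gap:
  assumes "u \<in> lattice" "v \<in> lattice" "snd u = snd v" "fst u < fst v"
  shows "fst u + 2 \<le> fst v"
proof -
  have "even (fst u + snd v)" "even (fst v + snd v)"
    using assms by (auto simp: lattice_def)
  then show ?thesis using assms(4) by presburger
qed

lemma anc_mono:
  assumes "u \<in> perc_points \<omega>" "v \<in> perc_points \<omega>" "snd u = snd v" "fst u \<le> fst v"
  shows "fst (anc \<omega> n u) \<le> fst (anc \<omega> n v)"
proof (induction n)
  case (Suc n)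
  let ?a = "anc \<omega> n u" and ?b = "anc \<omega> n v"
  have s: "snd ?a = snd ?b" using assms(3) by (simp add: snd_greedy)
  show ?case
  proof (cases "fst ?a = fst ?b")
    case True
    then have "?a = ?b" using s by (simp add: prod_eq_iff)
    then show ?thesis by simp
  next
    case False
    then have "fst ?a + 2 \<le> fst ?b"
      using Suc s perc_points_lattice[OF greedy_orbit[OF assms(1)]]
        perc_points_lattice[OF greedy_orbit[OF assms(2)]]
      by (intro lattice_same_level_gap) auto
    then show ?thesis
      using greedy_step_cases[of \<omega> ?a] greedy_step_cases[of \<omega> ?b] by auto
  qed
qed (use assms in simp)

lemma anc_eq_mono:
  assumes "anc \<omega> n u = anc \<omega> n v" "n \<le> m"
  shows "anc \<omega> m u = anc \<omega> m v"
  using assms by (metis anc_add le_add_diff_inverse2)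

lemma coalesce_refl: "coalesce \<omega> u u"
  by (simp add: coalesce_def)

lemma coalesce_sym: "coalesce \<omega> u v \<Longrightarrow> coalesce \<omega> v u"
  unfolding coalesce_def by metis

lemma coalesce_trans:
  assumes "coalesce \<omega> u v" "coalesce \<omega> v w"
  shows "coalesce \<omega> u w"
proof -
  obtain n m where "anc \<omega> n u = anc \<omega> n v" "anc \<omega> m v = anc \<omega> m w"
    using assms by (auto simp: coalesce_def)
  then have "anc \<omega> (max n m) u = anc \<omega> (max n m) w"
    by (metis anc_eq_mono max.cobounded1 max.cobounded2)
  then show ?thesis unfolding coalesce_def by blast
qed

text \<open>A path squeezed between two paths that have merged has merged with them.\<close>

lemma coalesce_between:
  assumes "u \<in> perc_points \<omega>" "v \<in> perc_points \<omega>" "w \<in> perc_points \<omega>"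
    and "snd u = snd v" "snd v = snd w" "fst u \<le> fst v" "fst v \<le> fst w" and "coalesce \<omega> u w"
  shows "coalesce \<omega> u v"
proof -
  obtain n where n: "anc \<omega> n u = anc \<omega> n w"
    using assms by (auto simp: coalesce_def)
  have "fst (anc \<omega> n u) \<le> fst (anc \<omega> n v)" "fst (anc \<omega> n v) \<le> fst (anc \<omega> n w)"
    using assms by (auto intro!: anc_mono)
  then have "anc \<omega> n u = anc \<omega> n v"
    using n assms(4) by (simp add: prod_eq_iff snd_greedy)
  then show ?thesis unfolding coalesce_def by blast
qed

lemma first_meeting:
  assumes "coalesce \<omega> u v" "u \<noteq> v"
  obtains n where "anc \<omega> n u \<noteq> anc \<omega> n v" "anc \<omega> (Suc n) u = anc \<omega> (Suc n) v"
proof -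
  let ?n = "LEAST n. anc \<omega> n u = anc \<omega> n v"
  have n: "anc \<omega> ?n u = anc \<omega> ?n v"
    using assms(1) unfolding coalesce_def by (rule LeastI_ex)
  then have "?n \<noteq> 0" using assms(2) by (metis funpow_0)
  then obtain k where k: "?n = Suc k" using not0_implies_Suc by blast
  then have "anc \<omega> k u \<noteq> anc \<omega> k v"
    using not_less_Least[of k] by force
  then show ?thesis using that n k by metis
qed

section \<open>Translations\<close>

text \<open>The configuration seen from \<open>t\<close>. The restriction keeps the image inside the sample space of the
  product measure.\<close>

definition translate :: "vertex \<Rightarrow> (edge \<Rightarrow> bool) \<Rightarrow> (edge \<Rightarrow> bool)" where
  "translate t \<omega> = (\<lambda>e\<in>lattice_edges. \<omega> (fst e + t, snd e + t))"

lemma lattice_add: "t \<in> lattice \<Longrightarrow> u + t \<in> lattice \<longleftrightarrow> u \<in> lattice"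
  by (cases u; cases t) (auto simp: lattice_def)

lemma lattice_edges_iff:
  "(u, v) \<in> lattice_edges \<longleftrightarrow> u \<in> lattice \<and> (v = u + (1, 1) \<or> v = u + (-1, 1))"
  by (cases u) (auto simp: lattice_edges_def)

lemma lattice_edges_shift:
  "t \<in> lattice \<Longrightarrow> (u + t, v + t) \<in> lattice_edges \<longleftrightarrow> (u, v) \<in> lattice_edges"
  by (cases u; cases v; cases t) (auto simp: lattice_edges_iff lattice_def)

lemma open_edges_shift:
  assumes "t \<in> lattice"
  shows "(u, v) \<in> open_edges (translate t \<omega>) \<longleftrightarrow> (u + t, v + t) \<in> open_edges \<omega>"
  using lattice_edges_shift[OF assms, of u v] by (auto simp: open_edges_def translate_def)

lemma reaches_shift:
  assumes "t \<in> lattice"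
  shows "reaches (translate t \<omega>) u v \<longleftrightarrow> reaches \<omega> (u + t) (v + t)"
proof
  assume "reaches (translate t \<omega>) u v"
  then have "(u, v) \<in> (open_edges (translate t \<omega>))\<^sup>*" by (simp add: reaches_def)
  then have "(u + t, v + t) \<in> (open_edges \<omega>)\<^sup>*"
    by induction (auto simp: open_edges_shift[OF assms] intro: rtrancl_into_rtrancl)
  then show "reaches \<omega> (u + t) (v + t)" by (simp add: reaches_def)
next
  have "(x - t, y - t) \<in> (open_edges (translate t \<omega>))\<^sup>*" if "(x, y) \<in> (open_edges \<omega>)\<^sup>*" for x y
    using that
    by induction (auto simp: open_edges_shift[OF assms] intro: rtrancl_into_rtrancl)
  from this[of "u + t" "v + t"]
  show "reaches (translate t \<omega>) u v" if "reaches \<omega> (u + t) (v + t)"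
    using that by (simp add: reaches_def)
qed

lemma perc_points_shift:
  assumes "t \<in> lattice"
  shows "u \<in> perc_points (translate t \<omega>) \<longleftrightarrow> u + t \<in> perc_points \<omega>"
proof -
  have "cluster \<omega> (u + t) = (\<lambda>v. v + t) ` cluster (translate t \<omega>) u"
  proof (intro set_eqI iffI)
    fix v assume "v \<in> cluster \<omega> (u + t)"
    then have "v - t \<in> cluster (translate t \<omega>) u"
      using lattice_add[OF assms, of "v - t"] by (simp add: cluster_def reaches_shift[OF assms])
    then show "v \<in> (\<lambda>v. v + t) ` cluster (translate t \<omega>) u" by (rule rev_image_eqI) simp
  qed (auto simp: cluster_def reaches_shift[OF assms] lattice_add[OF assms])
  then have "finite (cluster \<omega> (u + t)) \<longleftrightarrow> finite (cluster (translate t \<omega>) u)"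
    by (simp add: finite_image_iff inj_on_def)
  then show ?thesis by (simp add: perc_points_def lattice_add[OF assms])
qed

lemma greedy_step_shift:
  assumes "t \<in> lattice"
  shows "greedy_step (translate t \<omega>) u + t = greedy_step \<omega> (u + t)"
proof -
  have "(fst u + 1, snd u + 1) + t = (fst (u + t) + 1, snd (u + t) + 1)"
       "(fst u - 1, snd u + 1) + t = (fst (u + t) - 1, snd (u + t) + 1)"
    by (simp_all add: prod_eq_iff)
  then show ?thesis
    unfolding greedy_step_def Let_def
    by (simp only: open_edges_shift[OF assms] perc_points_shift[OF assms] if_distrib[of "\<lambda>x. x + t"])
qed

lemma anc_shift:
  assumes "t \<in> lattice"
  shows "anc (translate t \<omega>) n u + t = anc \<omega> n (u + t)"
  by (induction n) (simp_all add: greedy_step_shift[OF assms])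

lemma anc_shift_eq_iff:
  assumes "t \<in> lattice"
  shows "anc (translate t \<omega>) n u = v \<longleftrightarrow> anc \<omega> n (u + t) = v + t"
  by (metis anc_shift[OF assms] add_right_imp_eq)

lemma anc_shift_eq_anc_iff:
  assumes "t \<in> lattice"
  shows "anc (translate t \<omega>) n u = anc (translate t \<omega>) m v \<longleftrightarrow> anc \<omega> n (u + t) = anc \<omega> m (v + t)"
  by (metis anc_shift[OF assms] add_right_imp_eq)

lemma coalesce_shift: "t \<in> lattice \<Longrightarrow> coalesce (translate t \<omega>) u v \<longleftrightarrow> coalesce \<omega> (u + t) (v + t)"
  by (simp add: coalesce_def anc_shift_eq_anc_iff)

lemma all_vertices_shift: "(\<forall>v. P (v + t)) \<longleftrightarrow> (\<forall>v::vertex. P v)"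
  by (metis diff_add_cancel)

lemma ex_vertices_shift: "(\<exists>v. P (v + t)) \<longleftrightarrow> (\<exists>v::vertex. P v)"
  by (metis diff_add_cancel)

section \<open>Dependence on the edges above a level\<close>

definition upper_edges :: "int \<Rightarrow> edge set" where
  "upper_edges h = {e \<in> lattice_edges. h \<le> snd (fst e)}"

text \<open>Closing the edges outside \<open>J\<close>, rather than forgetting them, gives again a configuration; an event
  depends only on \<open>J\<close> if it does not notice this.\<close>

definition keep :: "edge set \<Rightarrow> (edge \<Rightarrow> bool) \<Rightarrow> (edge \<Rightarrow> bool)" where
  "keep J \<omega> = (\<lambda>e\<in>lattice_edges. e \<in> J \<and> \<omega> e)"

lemma open_edges_keep: "open_edges (keep J \<omega>) = open_edges \<omega> \<inter> J"
  by (auto simp: open_edges_def keep_def)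

lemma reaches_keep:
  assumes "h \<le> snd u"
  shows "reaches (keep (upper_edges h) \<omega>) u v \<longleftrightarrow> reaches \<omega> u v"
proof
  assume "reaches \<omega> u v"
  then have "(u, v) \<in> (open_edges \<omega>)\<^sup>*" by (simp add: reaches_def)
  then have "(u, v) \<in> (open_edges (keep (upper_edges h) \<omega>))\<^sup>* \<and> h \<le> snd v"
  proof induction
    case (step y z)
    then have "(y, z) \<in> open_edges (keep (upper_edges h) \<omega>)"
      by (auto simp: open_edges_def keep_def upper_edges_def)
    then show ?case using step open_edges_cases[OF step.hyps(2)]
      by (auto intro: rtrancl_into_rtrancl)
  qed (use assms in simp)
  then show "reaches (keep (upper_edges h) \<omega>) u v" by (simp add: reaches_def)
next
  assume "reaches (keep (upper_edges h) \<omega>) u v"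
  then show "reaches \<omega> u v"
    unfolding reaches_def open_edges_keep using rtrancl_mono[of "open_edges \<omega> \<inter> upper_edges h"] by blast
qed

lemma perc_points_keep:
  "h \<le> snd u \<Longrightarrow> u \<in> perc_points (keep (upper_edges h) \<omega>) \<longleftrightarrow> u \<in> perc_points \<omega>"
  by (simp add: perc_points_def cluster_def reaches_keep)

lemma greedy_step_keep:
  assumes "h \<le> snd u"
  shows "greedy_step (keep (upper_edges h) \<omega>) u = greedy_step \<omega> u"
proof -
  have "(u, v) \<in> open_edges (keep (upper_edges h) \<omega>) \<longleftrightarrow> (u, v) \<in> open_edges \<omega>" for v
    using assms by (auto simp: open_edges_def keep_def upper_edges_def)
  then show ?thesis
    using assms by (simp add: greedy_step_def Let_def perc_points_keep)
qed

lemma anc_keep: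
  assumes "h \<le> snd u"
  shows "anc (keep (upper_edges h) \<omega>) n u = anc \<omega> n u"
  by (induction n) (use assms in \<open>simp_all add: greedy_step_keep snd_greedy\<close>)

lemma coalesce_keep:
  "h \<le> snd u \<Longrightarrow> h \<le> snd v \<Longrightarrow> coalesce (keep (upper_edges h) \<omega>) u v \<longleftrightarrow> coalesce \<omega> u v"
  by (simp add: coalesce_def anc_keep)

section \<open>The percolation measure\<close>

lemma prob_space_percolation: "prob_space (percolation p)"
  unfolding percolation_def by (intro prob_space_PiM prob_space_measure_pmf)

lemma measurable_edge:
  "e \<in> lattice_edges \<Longrightarrow> (\<lambda>\<omega>. \<omega> e) \<in> measurable (percolation p) (measure_pmf (bernoulli_pmf p))"
  unfolding percolation_def by (rule measurable_component_singleton)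

lemma translate_edge_lattice:
  "t \<in> lattice \<Longrightarrow> e \<in> lattice_edges \<Longrightarrow> (fst e + t, snd e + t) \<in> lattice_edges"
  using lattice_edges_shift[of t "fst e" "snd e"] by simp

lemma measurable_translate:
  assumes "t \<in> lattice"
  shows "translate t \<in> measurable (percolation p) (percolation p)"
proof -
  have "(\<lambda>\<omega>. \<lambda>e\<in>lattice_edges. \<omega> (fst e + t, snd e + t))
      \<in> measurable (percolation p) (\<Pi>\<^sub>M e\<in>lattice_edges. measure_pmf (bernoulli_pmf p))"
    by (intro measurable_restrict measurable_edge translate_edge_lattice assms)
  then show ?thesis unfolding translate_def percolation_def[of p, symmetric] .
qed

lemma distr_translate:
  assumes "t \<in> lattice"
  shows "distr (percolation p) (percolation p) (translate t) = percolation p"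
proof -
  let ?f = "\<lambda>e::edge. (fst e + t, snd e + t)"
  have "distr (\<Pi>\<^sub>M e\<in>lattice_edges. measure_pmf (bernoulli_pmf p))
          (\<Pi>\<^sub>M e\<in>lattice_edges. measure_pmf (bernoulli_pmf p)) (\<lambda>\<omega>. \<lambda>e\<in>lattice_edges. \<omega> (?f e))
      = (\<Pi>\<^sub>M e\<in>lattice_edges. measure_pmf (bernoulli_pmf p))"
    by (rule distr_PiM_reindex)
       (auto simp: inj_on_def prod_eq_iff prob_space_measure_pmf
             intro!: translate_edge_lattice assms)
  then show ?thesis unfolding translate_def percolation_def .
qed

lemma measurable_perc_points:
  "Measurable.pred (percolation p) (\<lambda>\<omega>. u \<in> perc_points \<omega>)"
  using measurable_infinite_cluster[of p u] unfolding perc_points_def by (simp add: pred_def)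

lemma measurable_greedy_step_eq:
  "Measurable.pred (percolation p) (\<lambda>\<omega>. greedy_step \<omega> u = w)"
proof -
  let ?r = "(fst u + 1, snd u + 1)" and ?l = "(fst u - 1, snd u + 1)"
  have "(\<lambda>\<omega>. greedy_step \<omega> u = w) = (\<lambda>\<omega>.
      ((u, ?r) \<in> open_edges \<omega> \<and> ?r \<in> perc_points \<omega>) \<and> ?r = w \<or>
      \<not> ((u, ?r) \<in> open_edges \<omega> \<and> ?r \<in> perc_points \<omega>) \<and> ?l = w)"
    by (auto simp: fun_eq_iff greedy_step_def Let_def)
  then show ?thesis
    by (simp only:) (intro pred_intros_logic measurable_open_edges measurable_perc_points; simp)
qed

lemma measurable_anc_eq:
  "Measurable.pred (percolation p) (\<lambda>\<omega>. anc \<omega> n u = w)"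
proof (induction n arbitrary: w)
  case (Suc n)
  have "Measurable.pred (percolation p) (\<lambda>\<omega>. \<exists>x. anc \<omega> n u = x \<and> greedy_step \<omega> x = w)"
    by (intro pred_intros_countable pred_intros_logic Suc measurable_greedy_step_eq)
  then show ?case by simp
qed simp

lemma measurable_anc_eq_anc:
  "Measurable.pred (percolation p) (\<lambda>\<omega>. anc \<omega> n u = anc \<omega> m v)"
proof -
  have "Measurable.pred (percolation p) (\<lambda>\<omega>. \<exists>x. anc \<omega> n u = x \<and> anc \<omega> m v = x)"
    by (intro pred_intros_countable pred_intros_logic measurable_anc_eq)
  then show ?thesis by (simp add: eq_commute)
qed

lemma measurable_coalesce: "Measurable.pred (percolation p) (\<lambda>\<omega>. coalesce \<omega> u v)"
  unfolding coalesce_def by (intro pred_intros_countable measurable_anc_eq_anc)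

lemmas percolation_measurable =
  measurable_perc_points measurable_greedy_step_eq measurable_anc_eq measurable_anc_eq_anc
  measurable_coalesce

section \<open>Translation-covariant vertex properties\<close>

text \<open>Such a property is as likely at one lattice vertex as at any other, which is what makes the
  counting arguments below work.\<close>

definition covariant :: "((edge \<Rightarrow> bool) \<Rightarrow> vertex \<Rightarrow> bool) \<Rightarrow> bool" where
  "covariant Q \<longleftrightarrow> (\<forall>t\<in>lattice. \<forall>\<omega> u. Q (translate t \<omega>) u \<longleftrightarrow> Q \<omega> (u + t))"

lemma covariant_conj:
  "covariant P \<Longrightarrow> covariant Q \<Longrightarrow> covariant (\<lambda>\<omega> u. P \<omega> u \<and> Q \<omega> u)"
  by (simp add: covariant_def)

lemma covariant_all_nat:
  "(\<And>n. covariant (Q n)) \<Longrightarrow> covariant (\<lambda>\<omega> u. \<forall>n. Q n \<omega> u)"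
  by (simp add: covariant_def)

lemma covariant_perc_points: "covariant (\<lambda>\<omega> u. u \<in> perc_points \<omega>)"
  by (simp add: covariant_def perc_points_shift)

lemma covariant_all_vertices:
  assumes "\<And>t \<omega> u v. t \<in> lattice \<Longrightarrow> R (translate t \<omega>) u v \<longleftrightarrow> R \<omega> (u + t) (v + t)"
  shows "covariant (\<lambda>\<omega> u. \<forall>v. R \<omega> u v)"
  unfolding covariant_def using assms all_vertices_shift[of "R _ _"] by simp

lemma covariant_ex_vertex:
  assumes "\<And>t \<omega> u v. t \<in> lattice \<Longrightarrow> R (translate t \<omega>) u v \<longleftrightarrow> R \<omega> (u + t) (v + t)"
  shows "covariant (\<lambda>\<omega> u. \<exists>v. R \<omega> u v)"
  unfolding covariant_def using assms ex_vertices_shift[of "R _ _"] by simp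

lemma pred_prob_event:
  "Measurable.pred M Q \<Longrightarrow> {\<omega> \<in> space M. Q \<omega>} \<in> sets M"
  by (simp add: pred_def)

lemma prob_covariant:
  assumes Q: "covariant Q" "\<And>u. Measurable.pred (percolation p) (\<lambda>\<omega>. Q \<omega> u)"
    and u: "u \<in> lattice" and v: "v \<in> lattice"
  shows "measure (percolation p) {\<omega> \<in> space (percolation p). Q \<omega> u} =
         measure (percolation p) {\<omega> \<in> space (percolation p). Q \<omega> v}"
proof -
  let ?M = "percolation p"
  let ?t = "v - u"
  have t: "?t \<in> lattice" using u v by (auto simp: lattice_def)
  let ?A = "{\<omega> \<in> space ?M. Q \<omega> u}"
  have "measure ?M ?A = measure (distr ?M ?M (translate ?t)) ?A"
    by (simp add: distr_translate[OF t])
  also have "\<dots> = measure ?M (translate ?t -` ?A \<inter> space ?M)"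
    by (rule measure_distr[OF measurable_translate[OF t] pred_prob_event[OF Q(2)]])
  also have "translate ?t -` ?A \<inter> space ?M = {\<omega> \<in> space ?M. Q \<omega> v}"
  proof -
    have "Q (translate ?t \<omega>) u \<longleftrightarrow> Q \<omega> v" for \<omega>
      using Q(1) t unfolding covariant_def by (metis add.commute diff_add_cancel)
    then show ?thesis
      using measurable_space[OF measurable_translate[OF t], of _ p] by auto
  qed
  finally show ?thesis .
qed

text \<open>The expected number of vertices of \<open>B\<close> with the property is \<open>card B\<close> times the common
  probability of a single vertex.\<close>

lemma covariant_card_bound:
  assumes Q: "covariant Q" "\<And>u. Measurable.pred (percolation p) (\<lambda>\<omega>. Q \<omega> u)"
    and B: "finite B" "B \<subseteq> lattice" and u: "u \<in> lattice"
    and bound: "AE \<omega> in percolation p. card {v \<in> B. Q \<omega> v} \<le> c"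
  shows "real (card B) * measure (percolation p) {\<omega> \<in> space (percolation p). Q \<omega> u} \<le> real c"
proof -
  let ?M = "percolation p"
  interpret prob_space ?M by (rule prob_space_percolation)
  define A where "A v = {\<omega> \<in> space ?M. Q \<omega> v}" for v
  have A: "A v \<in> sets ?M" for v unfolding A_def by (rule pred_prob_event[OF Q(2)])
  have "real (card B) * prob (A u) = (\<Sum>v\<in>B. prob (A v))"
  proof -
    have "prob (A v) = prob (A u)" if "v \<in> B" for v
      unfolding A_def using prob_covariant[OF Q _ u] B(2) that by blast
    then show ?thesis by simp
  qed
  also have "\<dots> = expectation (\<lambda>\<omega>. \<Sum>v\<in>B. indicator (A v) \<omega>)"
    using A by (subst Bochner_Integration.integral_sum) (auto simp: integrable_indicator_iff emeasure_eq_measure)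
  also have "\<dots> \<le> real c"
  proof (rule integral_le_const)
    show "integrable ?M (\<lambda>\<omega>. \<Sum>v\<in>B. indicator (A v) \<omega> :: real)"
      using A by (intro Bochner_Integration.integrable_sum) (auto simp: integrable_indicator_iff emeasure_eq_measure)
    show "AE \<omega> in ?M. (\<Sum>v\<in>B. indicator (A v) \<omega> :: real) \<le> real c"
      using bound AE_space
    proof eventually_elim
      case (elim \<omega>)
      have "(\<Sum>v\<in>B. indicator (A v) \<omega> :: real) = real (card {v \<in> B. Q \<omega> v})"
        using elim(2) B(1) by (simp add: A_def indicator_def sum.If_cases Int_def)
      then show ?case using elim(1) by simp
    qed
  qed
  finally show ?thesis by (simp add: A_def)
qed

lemma zero_if_linear_bound:
  fixes x :: real
  assumes "0 \<le> x" "\<And>N::nat. real N * x \<le> c"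
  shows "x = 0"
proof (rule ccontr)
  assume "x \<noteq> 0"
  then obtain N :: nat where "c < real N * x"
    using reals_Archimedean3[of x] assms(1) by force
  then show False using assms(2)[of N] by simp
qed

lemma AE_not_covariant:
  assumes Q: "\<And>u. Measurable.pred (percolation p) (\<lambda>\<omega>. Q \<omega> u)"
    and "\<And>u. u \<in> lattice \<Longrightarrow> measure (percolation p) {\<omega> \<in> space (percolation p). Q \<omega> u} = 0"
  shows "AE \<omega> in percolation p. \<forall>u\<in>lattice. \<not> Q \<omega> u"
proof -
  interpret prob_space "percolation p" by (rule prob_space_percolation)
  have "AE \<omega> in percolation p. \<not> Q \<omega> u" if "u \<in> lattice" for u
  proof -
    have "AE \<omega> in percolation p. \<omega> \<notin> {\<omega> \<in> space (percolation p). Q \<omega> u}"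
      using prob_eq_0[OF pred_prob_event[OF Q]] assms(2)[OF that] by blast
    then show ?thesis using AE_space by eventually_elim simp
  qed
  then show ?thesis by (simp add: AE_ball_countable)
qed

text \<open>The \<open>N\<close> vertices \<open>(0, 0), (2, 0), ..., (2 * (N - 1), 0)\<close> share at most one occurrence, so each has
  probability at most \<open>1 / N\<close>.\<close>

lemma covariant_unique_on_levels:
  assumes Q: "covariant Q" "\<And>u. Measurable.pred (percolation p) (\<lambda>\<omega>. Q \<omega> u)"
    and unique: "AE \<omega> in percolation p. \<forall>u\<in>lattice. \<forall>v\<in>lattice. Q \<omega> u \<longrightarrow> Q \<omega> v \<longrightarrow> snd u = snd v \<longrightarrow> u = v"
  shows "AE \<omega> in percolation p. \<forall>u\<in>lattice. \<not> Q \<omega> u"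
proof (rule AE_not_covariant[OF Q(2)], rule zero_if_linear_bound)
  fix u and N :: nat
  assume u: "u \<in> lattice"
  define B where "B = (\<lambda>i. (2 * int i, 0::int)) ` {..<N}"
  have B: "finite B" "B \<subseteq> lattice" "card B = N"
    unfolding B_def by (auto simp: lattice_def card_image inj_on_def)
  have "AE \<omega> in percolation p. card {v \<in> B. Q \<omega> v} \<le> 1"
    using unique
  proof eventually_elim
    case (elim \<omega>)
    have "v = w" if "v \<in> {v \<in> B. Q \<omega> v}" "w \<in> {v \<in> B. Q \<omega> v}" for v w
    proof -
      have "snd v = snd w" using that by (auto simp: B_def)
      then show ?thesis using elim that B(2) by blast
    qed
    then show ?case using B(1) by (simp add: card_le_Suc0_iff_eq)
  qed
  from covariant_card_bound[OF Q B(1,2) u this]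
  show "real N * measure (percolation p) {\<omega> \<in> space (percolation p). Q \<omega> u} \<le> 1"
    using B(3) by simp
qed simp

section \<open>Independence of disjoint edge sets\<close>

lemma indep_edges:
  "prob_space.indep_vars (percolation p) (\<lambda>_. measure_pmf (bernoulli_pmf p)) (\<lambda>e \<omega>. \<omega> e) lattice_edges"
proof -
  let ?N = "measure_pmf (bernoulli_pmf p)"
  interpret E: product_prob_space "\<lambda>_. ?N" lattice_edges
    by unfold_locales
  interpret prob_space "percolation p" by (rule prob_space_percolation)
  have ne: "lattice_edges \<noteq> {}"
    using lattice_edges_iff[of "(0,0)" "(1,1)"] by (auto simp: lattice_def)
  have "distr (percolation p) (\<Pi>\<^sub>M e\<in>lattice_edges. ?N) (\<lambda>\<omega>. \<lambda>e\<in>lattice_edges. \<omega> e)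
      = distr (percolation p) (percolation p) (\<lambda>\<omega>. \<omega>)"
    unfolding percolation_def
    by (rule distr_cong) (auto simp: space_PiM fun_eq_iff restrict_def PiE_def extensional_def)
  also have "\<dots> = (\<Pi>\<^sub>M e\<in>lattice_edges. ?N)"
    by (simp add: percolation_def)
  also have "\<dots> = (\<Pi>\<^sub>M e\<in>lattice_edges. distr (percolation p) ?N (\<lambda>\<omega>. \<omega> e))"
    unfolding percolation_def by (intro PiM_cong refl E.PiM_component[symmetric])
  finally show ?thesis
    by (subst indep_vars_iff_distr_eq_PiM'[OF ne measurable_edge]) simp_all
qed

definition edge_generators :: "real \<Rightarrow> edge \<Rightarrow> (edge \<Rightarrow> bool) set set" where
  "edge_generators p e =
     {(\<lambda>\<omega>. \<omega> e) -` A \<inter> space (percolation p) | A. A \<in> sets (measure_pmf (bernoulli_pmf p))}"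

definition edge_events :: "real \<Rightarrow> edge set \<Rightarrow> (edge \<Rightarrow> bool) set set" where
  "edge_events p J = sigma_sets (space (percolation p)) (\<Union>e\<in>J. edge_generators p e)"

lemma edge_generators_space: "edge_generators p e \<subseteq> Pow (space (percolation p))"
  by (auto simp: edge_generators_def)

lemma sigma_algebra_edge_events: "sigma_algebra (space (percolation p)) (edge_events p J)"
  unfolding edge_events_def using edge_generators_space by (intro sigma_algebra_sigma_sets) blast

lemma indep_edge_events:
  assumes "disjoint_family_on J L" "\<And>j. j \<in> L \<Longrightarrow> J j \<subseteq> lattice_edges"
  shows "prob_space.indep_sets (percolation p) (\<lambda>j. edge_events p (J j)) L"
proof -
  interpret prob_space "percolation p" by (rule prob_space_percolation)
  have base: "indep_sets (edge_generators p) lattice_edges"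
    unfolding edge_generators_def[abs_def]
    by (rule indep_edges[of p, unfolded indep_vars_def2, THEN conjunct2])
  have gen: "indep_sets (edge_generators p) (\<Union>j\<in>L. J j)"
  proof (rule indep_sets_mono_index[OF _ base])
    show "(\<Union>j\<in>L. J j) \<subseteq> lattice_edges" using assms(2) by blast
  qed
  have int: "Int_stable (edge_generators p i)" for i
  proof (rule Int_stableI)
    fix a b assume "a \<in> edge_generators p i" "b \<in> edge_generators p i"
    then obtain A B where "a = (\<lambda>\<omega>. \<omega> i) -` A \<inter> space (percolation p)"
      "b = (\<lambda>\<omega>. \<omega> i) -` B \<inter> space (percolation p)"
      unfolding edge_generators_def by blast
    then have "a \<inter> b = (\<lambda>\<omega>. \<omega> i) -` (A \<inter> B) \<inter> space (percolation p)" by blast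
    moreover have "A \<inter> B \<in> sets (measure_pmf (bernoulli_pmf p))" by simp
    ultimately show "a \<inter> b \<in> edge_generators p i" unfolding edge_generators_def by blast
  qed
  show ?thesis
    unfolding edge_events_def
    by (rule indep_sets_collect_sigma[where E = "edge_generators p" and I = J, OF gen int assms(1)])
qed

lemma keep_measurable_edge_events:
  assumes "J \<subseteq> lattice_edges"
  shows "keep J \<in> measurable (sigma (space (percolation p)) (\<Union>e\<in>J. edge_generators p e)) (percolation p)"
proof -
  let ?G = "\<Union>e\<in>J. edge_generators p e"
  let ?S = "sigma (space (percolation p)) ?G"
  have G: "?G \<subseteq> Pow (space (percolation p))" using edge_generators_space by blast
  have "(\<lambda>\<omega>. e \<in> J \<and> \<omega> e) \<in> measurable ?S (measure_pmf (bernoulli_pmf p))" for e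
  proof (cases "e \<in> J")
    case True
    show ?thesis
    proof (rule measurableI)
      fix A assume "A \<in> sets (measure_pmf (bernoulli_pmf p))"
      then have "(\<lambda>\<omega>. \<omega> e) -` A \<inter> space (percolation p) \<in> ?G"
        using True unfolding edge_generators_def by blast
      then show "(\<lambda>\<omega>. e \<in> J \<and> \<omega> e) -` A \<inter> space ?S \<in> sets ?S"
        using True G by (simp add: sets_measure_of space_measure_of_conv sigma_sets.Basic)
    qed simp
  qed simp
  then have "(\<lambda>\<omega>. \<lambda>e\<in>lattice_edges. e \<in> J \<and> \<omega> e) \<in>
      measurable ?S (\<Pi>\<^sub>M e\<in>lattice_edges. measure_pmf (bernoulli_pmf p))"
    by (intro measurable_restrict)
  then show ?thesis unfolding keep_def percolation_def[of p, symmetric] .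
qed

text \<open>An event that is unchanged when the edges outside \<open>J\<close> are closed is its own preimage under
  \<^term>\<open>keep J\<close>, and this map is measurable with respect to the edges in \<open>J\<close>.\<close>

lemma edge_eventsI:
  assumes J: "J \<subseteq> lattice_edges" and Q: "Measurable.pred (percolation p) Q"
    and local: "\<And>\<omega>. Q (keep J \<omega>) \<longleftrightarrow> Q \<omega>"
  shows "{\<omega> \<in> space (percolation p). Q \<omega>} \<in> edge_events p J"
proof -
  let ?G = "\<Union>e\<in>J. edge_generators p e"
  let ?S = "sigma (space (percolation p)) ?G"
  have G: "?G \<subseteq> Pow (space (percolation p))" using edge_generators_space by blast
  have "keep J -` {\<omega> \<in> space (percolation p). Q \<omega>} \<inter> space ?S \<in> sets ?S"
    by (rule measurable_sets[OF keep_measurable_edge_events[OF J] pred_prob_event[OF Q]])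
  also have "keep J -` {\<omega> \<in> space (percolation p). Q \<omega>} \<inter> space ?S = {\<omega> \<in> space (percolation p). Q \<omega>}"
    using measurable_space[OF keep_measurable_edge_events[OF J, of p]] local
    by (auto simp: space_measure_of_conv)
  finally show ?thesis using G by (simp add: edge_events_def sets_measure_of)
qed

lemma edge_events_indep:
  assumes "J \<inter> J' = {}" "J \<subseteq> lattice_edges" "J' \<subseteq> lattice_edges"
    and "A \<in> edge_events p J" "B \<in> edge_events p J'"
  shows "measure (percolation p) (A \<inter> B) = measure (percolation p) A * measure (percolation p) B"
proof -
  interpret prob_space "percolation p" by (rule prob_space_percolation)
  have "indep_sets (\<lambda>b. edge_events p (if b then J else J')) UNIV"
    by (rule indep_edge_events) (use assms in \<open>auto simp: disjoint_family_on_def\<close>)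
  from indep_setsD[OF this, of UNIV "\<lambda>b. if b then A else B"] assms
  show ?thesis by (simp add: UNIV_bool Int_commute mult.commute)
qed

lemma prob_all_closed:
  assumes "finite F" "F \<subseteq> lattice_edges" "0 \<le> p" "p < 1"
  shows "measure (percolation p) {\<omega> \<in> space (percolation p). \<forall>e\<in>F. \<not> \<omega> e} > 0"
proof -
  let ?N = "measure_pmf (bernoulli_pmf p)"
  interpret E: product_prob_space "\<lambda>_. ?N" lattice_edges by unfold_locales
  have "emeasure (percolation p) {\<omega> \<in> space (percolation p). \<forall>e\<in>F. \<omega> e \<in> {False}}
      = (\<Prod>e\<in>F. emeasure ?N {False})"
    unfolding percolation_def by (rule E.emeasure_PiM_Collect) (use assms in auto)
  also have "\<dots> = ennreal ((1 - p) ^ card F)"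
    using assms by (simp add: emeasure_pmf_single ennreal_power)
  finally have "measure (percolation p) {\<omega> \<in> space (percolation p). \<forall>e\<in>F. \<omega> e \<in> {False}} = (1 - p) ^ card F"
    using assms by (simp add: measure_def)
  then show ?thesis using assms by simp
qed

section \<open>No component has a lowest point\<close>

text \<open>The left-most point on the lowest level of a component, if the component has one. Breaking ties
  to the left makes it unique, so that these points can be counted.\<close>

definition lowest :: "(edge \<Rightarrow> bool) \<Rightarrow> vertex \<Rightarrow> bool" where
  "lowest \<omega> u \<longleftrightarrow> u \<in> perc_points \<omega> \<and>
     (\<forall>v. v \<in> perc_points \<omega> \<longrightarrow> (\<exists>n m. anc \<omega> n v = anc \<omega> m u) \<longrightarrow>
          snd u < snd v \<or> snd u = snd v \<and> fst u \<le> fst v)"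

lemma covariant_lowest: "covariant lowest"
  unfolding lowest_def[abs_def]
  by (intro covariant_conj covariant_perc_points covariant_all_vertices)
     (simp add: perc_points_shift anc_shift_eq_anc_iff)

lemma measurable_lowest: "Measurable.pred (percolation p) (\<lambda>\<omega>. lowest \<omega> u)"
  unfolding lowest_def
  by (intro pred_intros_countable pred_intros_logic percolation_measurable; simp)

lemma lowest_unique:
  assumes "lowest \<omega> u" "lowest \<omega> v" "anc \<omega> n u = anc \<omega> m v"
  shows "u = v"
proof -
  have "snd v < snd u \<or> snd v = snd u \<and> fst v \<le> fst u"
    using assms unfolding lowest_def by blast
  moreover have "snd u < snd v \<or> snd u = snd v \<and> fst u \<le> fst v"
    using assms unfolding lowest_def by metis
  ultimately show ?thesis by (auto simp: prod_eq_iff)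
qed

text \<open>Different lowest points have disjoint paths, which are therefore at different places when
  they reach level \<open>N\<close>. Starting in a sheared box with \<open>0 \<le> x \<le> 3 * N\<close> and making at most \<open>N\<close> steps,
  they end in \<open>{-N..4 * N}\<close>. The shear keeps the box inside the lattice.\<close>

lemma card_lowest_box:
  fixes N :: nat
  defines "B \<equiv> (\<lambda>(i, j). (2 * int i + int j, int j)) ` ({..<N} \<times> {..<N})"
  shows "card {u \<in> B. lowest \<omega> u} \<le> 5 * N + 1"
proof -
  let ?top = "\<lambda>u. anc \<omega> (nat (int N - snd u)) u"
  let ?S = "{u \<in> B. lowest \<omega> u}"
  have lev: "snd (?top u) = int N" if "u \<in> B" for u
    using that by (auto simp: B_def snd_greedy)
  have "inj_on (\<lambda>u. fst (?top u)) ?S"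
  proof (rule inj_onI)
    fix u v assume u: "u \<in> ?S" and v: "v \<in> ?S" and eq: "fst (?top u) = fst (?top v)"
    have top: "?top u = ?top v" using u v eq lev by (simp add: prod_eq_iff)
    show "u = v" by (rule lowest_unique[OF _ _ top]) (use u v in simp_all)
  qed
  moreover have "(\<lambda>u. fst (?top u)) ` ?S \<subseteq> {- int N..4 * int N}"
  proof (intro image_subsetI)
    fix u assume "u \<in> ?S"
    then obtain i j where "u = (2 * int i + int j, int j)" "i < N" "j < N"
      by (auto simp: B_def)
    then show "fst (?top u) \<in> {- int N..4 * int N}"
      using fst_anc_bound[of "nat (int N - snd u)" \<omega> u] by auto
  qed
  ultimately have "card ?S \<le> card {- int N..4 * int N}"
    by (intro card_inj_on_le) auto
  then show ?thesis by (simp add: nat_add_distrib nat_mult_distrib)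
qed

lemma AE_no_lowest: "AE \<omega> in percolation p. \<forall>u\<in>lattice. \<not> lowest \<omega> u"
proof (rule AE_not_covariant[OF measurable_lowest], rule zero_if_linear_bound)
  fix u and N :: nat
  assume u: "u \<in> lattice"
  let ?x = "measure (percolation p) {\<omega> \<in> space (percolation p). lowest \<omega> u}"
  define B where "B = (\<lambda>(i, j). (2 * int i + int j, int j)) ` ({..<N} \<times> {..<N})"
  have "inj_on (\<lambda>(i, j). (2 * int i + int j, int j)) ({..<N} \<times> {..<N})"
    by (auto simp: inj_on_def)
  then have B: "finite B" "B \<subseteq> lattice" "card B = N * N"
    unfolding B_def by (auto simp: lattice_def card_image)
  have "real (N * N) * ?x \<le> real (5 * N + 1)"
    using covariant_card_bound[OF covariant_lowest measurable_lowest B(1,2) u, where c = "5 * N + 1"]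
      card_lowest_box[where N = N] B(3) unfolding B_def by simp
  then show "real N * ?x \<le> 6"
  proof (cases "N = 0")
    case False
    have "real N * (real N * ?x) \<le> 5 * real N + 1"
      using \<open>real (N * N) * ?x \<le> real (5 * N + 1)\<close> by (simp add: algebra_simps)
    also have "\<dots> \<le> real N * 6" using False by simp
    finally show ?thesis using False by simp
  qed simp
qed simp

section \<open>At most two components\<close>

text \<open>The paths from \<open>u1\<close> and \<open>u3\<close> form a wall on either side of the component of \<open>u2\<close>, and the
  closed edges form its floor. So the component meets its lowest level, that of \<open>u2\<close>, in a finite
  set, whose left-most element is the required vertex.\<close>

lemma lowest_exists_if_isolated:
  assumes K: "u1 \<in> perc_points \<omega>" "u2 \<in> perc_points \<omega>" "u3 \<in> perc_points \<omega>"
    and lev: "snd u1 = snd u2" "snd u3 = snd u2" and ord: "fst u1 \<le> fst u2" "fst u2 \<le> fst u3"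
    and nm: "\<not> coalesce \<omega> u1 u2" "\<not> coalesce \<omega> u2 u3"
    and closed: "\<And>v w. (v, w) \<in> open_edges \<omega> \<Longrightarrow> snd w = snd u2 \<Longrightarrow>
                   fst u1 \<le> fst w \<Longrightarrow> fst w \<le> fst u3 \<Longrightarrow> False"
  shows "\<exists>u\<in>lattice. lowest \<omega> u"
proof -
  have enclosed: "fst u1 < fst v \<and> fst v < fst u3"
    if v: "v \<in> perc_points \<omega>" "snd v = snd u2" "coalesce \<omega> v u2" for v
  proof (intro conjI; rule ccontr)
    assume "\<not> fst u1 < fst v"
    then have "coalesce \<omega> v u1" using v K lev ord by (intro coalesce_between[of v \<omega> u1 u2]) auto
    then show False using v nm coalesce_sym coalesce_trans by blast
  next
    assume "\<not> fst v < fst u3"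
    then have "coalesce \<omega> u2 u3" using v K lev ord coalesce_sym by (intro coalesce_between[of u2 \<omega> u3 v]) auto
    then show False using nm by blast
  qed
  have low: "snd u2 \<le> snd v" if v: "v \<in> perc_points \<omega>" "anc \<omega> n v = anc \<omega> m u2" for v n m
  proof (rule ccontr)
    assume "\<not> snd u2 \<le> snd v"
    then obtain k where k: "snd u2 = snd v + int (Suc k)"
      using zless_iff_Suc_zadd[of "snd v" "snd u2"] by auto
    let ?w = "anc \<omega> (Suc k) v"
    have w: "?w \<in> perc_points \<omega>" "snd ?w = snd u2"
      using greedy_orbit[OF v(1), of "Suc k"] snd_greedy[of "Suc k" \<omega> v] k by simp_all
    have "n = m + Suc k"
      using arg_cong[OF v(2), of snd] k by (simp add: snd_greedy)
    then have "anc \<omega> m ?w = anc \<omega> m u2" using v(2) by (simp only: anc_add)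
    then have "coalesce \<omega> ?w u2" unfolding coalesce_def by blast
    moreover have "(anc \<omega> k v, ?w) \<in> open_edges \<omega>"
      using greedy_step_open(1)[OF greedy_orbit[OF v(1), of k]] by simp
    ultimately show False using enclosed[OF w] closed[of "anc \<omega> k v" ?w] w(2) by force
  qed
  \<comment> \<open>the lowest level of the component of \<open>u2\<close>\<close>
  define S where "S = {v \<in> perc_points \<omega>. snd v = snd u2 \<and> coalesce \<omega> v u2}"
  have "S \<subseteq> {fst u1..fst u3} \<times> {snd u2}" using enclosed by (force simp: S_def)
  then have "finite S" by (rule finite_subset) simp
  moreover have "u2 \<in> S" using K(2) coalesce_refl by (simp add: S_def)
  ultimately obtain x where "is_arg_min fst (\<lambda>v. v \<in> S) x"
    using ex_is_arg_min_if_finite[of S fst] by blast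
  then have x: "x \<in> S" "\<And>v. v \<in> S \<Longrightarrow> fst x \<le> fst v"
    unfolding is_arg_min_linorder by blast+
  have xK: "x \<in> perc_points \<omega>" "snd x = snd u2" "coalesce \<omega> x u2" using x(1) by (auto simp: S_def)
  have "snd x < snd v \<or> snd x = snd v \<and> fst x \<le> fst v"
    if v: "v \<in> perc_points \<omega>" "anc \<omega> n v = anc \<omega> m x" for v n m
  proof -
    obtain j where j: "anc \<omega> j x = anc \<omega> j u2" using xK(3) by (auto simp: coalesce_def)
    have "anc \<omega> (j + n) v = anc \<omega> (j + m) x"
      by (metis anc_add v(2))
    also have "\<dots> = anc \<omega> (j + m) u2" by (rule anc_eq_mono[OF j]) simp
    finally have conn: "anc \<omega> (j + n) v = anc \<omega> (j + m) u2" .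
    show ?thesis
    proof (cases "snd v = snd u2")
      case True
      then have "n = m"
        using arg_cong[OF v(2), of snd] xK(2) by (simp add: snd_greedy)
      then have "coalesce \<omega> v u2" using conn unfolding coalesce_def by blast
      then have "v \<in> S" using v(1) True by (simp add: S_def)
      then show ?thesis using x(2) True xK(2) by simp
    qed (use low[OF v(1) conn] xK(2) in simp)
  qed
  then have "lowest \<omega> x" unfolding lowest_def using xK(1) by blast
  then show ?thesis using perc_points_lattice[OF xK(1)] by blast
qed

text \<open>The paths depend on the edges above the level of \<open>u2\<close> and the floor on finitely many edges below
  it. By independence, the event that the three paths stay apart and the floor is closed has positive
  probability if the first of these has.\<close>

lemma AE_not_three_components:
  assumes "0 \<le> p" "p < 1"
  shows "AE \<omega> in percolation p. \<forall>u1 u2 u3.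
    u1 \<in> perc_points \<omega> \<longrightarrow> u2 \<in> perc_points \<omega> \<longrightarrow> u3 \<in> perc_points \<omega> \<longrightarrow>
    snd u1 = snd u2 \<longrightarrow> snd u3 = snd u2 \<longrightarrow> fst u1 \<le> fst u2 \<longrightarrow> fst u2 \<le> fst u3 \<longrightarrow>
    coalesce \<omega> u1 u2 \<or> coalesce \<omega> u2 u3"
proof -
  let ?M = "percolation p"
  interpret prob_space ?M by (rule prob_space_percolation)
  have "AE \<omega> in ?M. \<not> (u1 \<in> perc_points \<omega> \<and> u2 \<in> perc_points \<omega> \<and> u3 \<in> perc_points \<omega> \<and>
          \<not> coalesce \<omega> u1 u2 \<and> \<not> coalesce \<omega> u2 u3)" (is "AE \<omega> in ?M. \<not> ?bad \<omega>")
    if lev: "snd u1 = snd u2" "snd u3 = snd u2" and ord: "fst u1 \<le> fst u2" "fst u2 \<le> fst u3"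
    for u1 u2 u3
  proof -
    let ?J = "upper_edges (snd u2)"
    define F where "F = {e \<in> lattice_edges. snd (snd e) = snd u2 \<and> fst u1 \<le> fst (snd e) \<and> fst (snd e) \<le> fst u3}"
    have below: "snd (fst e) = snd u2 - 1" if "e \<in> F" for e
      using that by (cases e) (auto simp: F_def lattice_edges_iff)
    have "F \<subseteq> ({fst u1 - 1..fst u3 + 1} \<times> {snd u2 - 1}) \<times> ({fst u1..fst u3} \<times> {snd u2})"
      by (force simp: F_def lattice_edges_iff)
    then have "finite F" by (rule finite_subset) simp
    have F: "F \<subseteq> lattice_edges - ?J" using below by (fastforce simp: F_def upper_edges_def)
    have meas: "Measurable.pred ?M ?bad" "Measurable.pred ?M (\<lambda>\<omega>. \<forall>e\<in>F. \<not> \<omega> e)"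
      subgoal by (intro pred_intros_logic percolation_measurable)
      subgoal
      proof -
        have "(\<lambda>\<omega>. \<forall>e\<in>F. \<not> \<omega> e) = (\<lambda>\<omega>. \<forall>e\<in>F. e \<notin> open_edges \<omega>)"
          using F by (auto simp: open_edges_def fun_eq_iff)
        moreover have "Measurable.pred ?M (\<lambda>\<omega>. \<forall>e\<in>F. e \<notin> open_edges \<omega>)"
          by (intro pred_intros_finite \<open>finite F\<close> pred_intros_logic measurable_open_edges)
        ultimately show ?thesis by (simp only:)
      qed
      done
    let ?U = "{\<omega> \<in> space ?M. ?bad \<omega>}" and ?V = "{\<omega> \<in> space ?M. \<forall>e\<in>F. \<not> \<omega> e}"
    have U: "?U \<in> edge_events p ?J"
      by (rule edge_eventsI[OF _ meas(1)])
         (use lev in \<open>auto simp: upper_edges_def[of "snd u2"] perc_points_keep[unfolded upper_edges_def] coalesce_keep[unfolded upper_edges_def]\<close>)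
    have V: "?V \<in> edge_events p (lattice_edges - ?J)"
    proof (rule edge_eventsI[OF _ meas(2)])
      show "(\<forall>e\<in>F. \<not> keep (lattice_edges - ?J) \<omega> e) \<longleftrightarrow> (\<forall>e\<in>F. \<not> \<omega> e)" for \<omega>
        using F by (auto simp: keep_def)
    qed simp
    have "prob (?U \<inter> ?V) = 0"
    proof -
      have "AE \<omega> in ?M. \<omega> \<notin> ?U \<inter> ?V"
        using AE_no_lowest
      proof eventually_elim
        case (elim \<omega>)
        show ?case
        proof
          assume \<omega>: "\<omega> \<in> ?U \<inter> ?V"
          then have "\<exists>u\<in>lattice. lowest \<omega> u"
            by (intro lowest_exists_if_isolated[of u1 \<omega> u2 u3] lev ord)
               (auto simp: F_def open_edges_def)
          then show False using elim by blast
        qed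
      qed
      moreover have "?U \<inter> ?V \<in> sets ?M"
        by (intro sets.Int pred_prob_event meas)
      ultimately show ?thesis using prob_eq_0 by blast
    qed
    moreover have "prob (?U \<inter> ?V) = prob ?U * prob ?V"
      by (rule edge_events_indep[OF _ _ _ U V]) (auto simp: upper_edges_def)
    moreover have "prob ?V > 0"
      using F by (intro prob_all_closed \<open>finite F\<close> assms) auto
    ultimately have "prob ?U = 0" by simp
    then have "AE \<omega> in ?M. \<omega> \<notin> ?U" using prob_eq_0[OF pred_prob_event[OF meas(1)]] by blast
    then show ?thesis using AE_space by eventually_elim simp
  qed
  then have "AE \<omega> in ?M. \<forall>u1 u2 u3. snd u1 = snd u2 \<longrightarrow> snd u3 = snd u2 \<longrightarrow>
      fst u1 \<le> fst u2 \<longrightarrow> fst u2 \<le> fst u3 \<longrightarrow>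
      \<not> (u1 \<in> perc_points \<omega> \<and> u2 \<in> perc_points \<omega> \<and> u3 \<in> perc_points \<omega> \<and>
          \<not> coalesce \<omega> u1 u2 \<and> \<not> coalesce \<omega> u2 u3)"
    unfolding AE_all_countable by (intro allI AE_impI)
  then show ?thesis by eventually_elim blast
qed

section \<open>All paths coalesce\<close>

text \<open>The witness to the right matters: it turns two such vertices on one level into three
  separate components.\<close>

definition last_of_component :: "(edge \<Rightarrow> bool) \<Rightarrow> vertex \<Rightarrow> bool" where
  "last_of_component \<omega> u \<longleftrightarrow> u \<in> perc_points \<omega> \<and>
     (\<exists>v. v \<in> perc_points \<omega> \<and> snd u = snd v \<and> fst u < fst v) \<and>
     (\<forall>v. v \<in> perc_points \<omega> \<longrightarrow> snd u = snd v \<longrightarrow> fst u < fst v \<longrightarrow> \<not> coalesce \<omega> u v)"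

lemma covariant_last_of_component: "covariant last_of_component"
  unfolding last_of_component_def[abs_def]
  by (intro covariant_conj covariant_perc_points covariant_all_vertices covariant_ex_vertex)
     (simp_all add: perc_points_shift coalesce_shift)

lemma measurable_last_of_component:
  "Measurable.pred (percolation p) (\<lambda>\<omega>. last_of_component \<omega> u)"
  unfolding last_of_component_def
  by (intro pred_intros_countable pred_intros_logic percolation_measurable; simp)

lemma AE_no_last_of_component:
  assumes "0 \<le> p" "p < 1"
  shows "AE \<omega> in percolation p. \<forall>u\<in>lattice. \<not> last_of_component \<omega> u"
proof (rule covariant_unique_on_levels[OF covariant_last_of_component measurable_last_of_component])
  show "AE \<omega> in percolation p. \<forall>u\<in>lattice. \<forall>v\<in>lattice. last_of_component \<omega> u \<longrightarrow>
          last_of_component \<omega> v \<longrightarrow> snd u = snd v \<longrightarrow> u = v"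
    using AE_not_three_components[OF assms]
  proof eventually_elim
    case (elim \<omega>)
    have no: False if u: "last_of_component \<omega> u" and v: "last_of_component \<omega> v"
      and uv: "snd u = snd v" "fst u < fst v" for u v
    proof -
      obtain w where w: "w \<in> perc_points \<omega>" "snd v = snd w" "fst v < fst w"
        using v unfolding last_of_component_def by blast
      have K: "u \<in> perc_points \<omega>" "v \<in> perc_points \<omega>"
        using u v unfolding last_of_component_def by blast+
      have "\<not> coalesce \<omega> u v" "\<not> coalesce \<omega> v w"
        using u v uv w K unfolding last_of_component_def by blast+
      moreover have "coalesce \<omega> u v \<or> coalesce \<omega> v w"
        by (rule elim[rule_format]) (use K uv w in simp_all)
      ultimately show False by blast
    qed
    have "u = v" if "last_of_component \<omega> u" "last_of_component \<omega> v" "snd u = snd v" for u v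
    proof -
      have "\<not> fst u < fst v" "\<not> fst v < fst u"
        using no[OF that] no[OF that(2,1) that(3)[symmetric]] by blast+
      then show ?thesis using that(3) by (simp add: prod_eq_iff)
    qed
    then show ?case by blast
  qed
qed

text \<open>If \<open>a\<close> and \<open>b\<close> lie on one level and do not coalesce, the right-most point before \<open>b\<close> that
  coalesces with \<open>a\<close> is the last of its component: a point beyond \<open>b\<close> that coalesces with \<open>a\<close> would
  force \<open>b\<close> to do so.\<close>

lemma AE_coalesce:
  assumes "0 \<le> p" "p < 1"
  shows "AE \<omega> in percolation p. \<forall>u v. u \<in> perc_points \<omega> \<longrightarrow> v \<in> perc_points \<omega> \<longrightarrow>
           snd u = snd v \<longrightarrow> coalesce \<omega> u v"
  using AE_no_last_of_component[OF assms]
proof eventually_elim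
  case (elim \<omega>)
  have left: "coalesce \<omega> a b"
    if a: "a \<in> perc_points \<omega>" and b: "b \<in> perc_points \<omega>" and lev: "snd a = snd b"
      and ord: "fst a \<le> fst b" for a b
  proof (rule ccontr)
    assume nm: "\<not> coalesce \<omega> a b"
    define S where "S = {x \<in> perc_points \<omega>. snd x = snd a \<and> fst a \<le> fst x \<and> fst x \<le> fst b \<and> coalesce \<omega> a x}"
    have "S \<subseteq> {fst a..fst b} \<times> {snd a}" by (force simp: S_def)
    then have "finite S" by (rule finite_subset) simp
    moreover have "a \<in> S" using a ord coalesce_refl by (simp add: S_def)
    ultimately obtain x where "is_arg_min (\<lambda>v. - fst v) (\<lambda>v. v \<in> S) x"
      using ex_is_arg_min_if_finite[of S "\<lambda>v. - fst v"] by blast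
    then have x: "x \<in> S" "\<And>v. v \<in> S \<Longrightarrow> fst v \<le> fst x"
      unfolding is_arg_min_linorder by (metis neg_le_iff_le)+
    have xK: "x \<in> perc_points \<omega>" "snd x = snd a" "fst a \<le> fst x" "fst x \<le> fst b" "coalesce \<omega> a x"
      using x(1) by (auto simp: S_def)
    have "x \<noteq> b" using xK(5) nm by auto
    then have "fst x < fst b" using xK lev by (auto simp: prod_eq_iff)
    moreover have "\<not> coalesce \<omega> x v"
      if v: "v \<in> perc_points \<omega>" "snd x = snd v" "fst x < fst v" for v
    proof
      assume "coalesce \<omega> x v"
      then have av: "coalesce \<omega> a v" using xK(5) coalesce_trans by blast
      show False
      proof (cases "fst v \<le> fst b")
        case True
        then have "v \<in> S" using v xK av by (simp add: S_def)
        then show False using x(2) v(3) by fastforce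
      next
        case False
        then have "coalesce \<omega> a b"
          using coalesce_between[of a \<omega> b v] a b v xK lev ord av by simp
        then show False using nm by blast
      qed
    qed
    ultimately have "last_of_component \<omega> x"
      unfolding last_of_component_def using xK(1,2) b lev by metis
    then show False using elim perc_points_lattice[OF xK(1)] by blast
  qed
  show ?case
  proof (intro allI impI)
    fix u v assume "u \<in> perc_points \<omega>" "v \<in> perc_points \<omega>" "snd u = snd v"
    then show "coalesce \<omega> u v"
      using left[of u v] left[of v u] coalesce_sym by (cases "fst u \<le> fst v") auto
  qed
qed

section \<open>Finite branches\<close>

text \<open>The vertices with descendants in every generation, that is, those with infinite branches.\<close>

definition ancient :: "(edge \<Rightarrow> bool) \<Rightarrow> vertex \<Rightarrow> bool" where
  "ancient \<omega> u \<longleftrightarrow> u \<in> perc_points \<omega> \<and> (\<forall>n. \<exists>v. v \<in> perc_points \<omega> \<and> anc \<omega> n v = u)"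

lemma covariant_ancient: "covariant ancient"
  unfolding ancient_def[abs_def]
  by (intro covariant_conj covariant_perc_points covariant_all_nat covariant_ex_vertex)
     (simp_all add: perc_points_shift anc_shift_eq_iff)

lemma measurable_ancient: "Measurable.pred (percolation p) (\<lambda>\<omega>. ancient \<omega> u)"
  unfolding ancient_def
  by (intro pred_intros_countable pred_intros_logic percolation_measurable; simp)

lemma ancient_greedy_step:
  assumes "ancient \<omega> u"
  shows "ancient \<omega> (greedy_step \<omega> u)"
  unfolding ancient_def
proof (intro conjI allI)
  have u: "u \<in> perc_points \<omega>" using assms by (simp add: ancient_def)
  then show "greedy_step \<omega> u \<in> perc_points \<omega>" by (rule greedy_step_open)
  fix n
  obtain v where v: "v \<in> perc_points \<omega>" "anc \<omega> n v = u"
    using assms unfolding ancient_def by blast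
  have "anc \<omega> n (greedy_step \<omega> v) = greedy_step \<omega> u"
    using v(2) by (metis funpow_swap1)
  then show "\<exists>v. v \<in> perc_points \<omega> \<and> anc \<omega> n v = greedy_step \<omega> u"
    using greedy_step_open(2)[OF v(1)] by blast
qed

text \<open>Of the at most two daughters one must have descendants in every generation; otherwise the
  descendants of \<open>u\<close> would die out one generation after those of the more persistent daughter.\<close>

lemma ancient_daughter:
  assumes "ancient \<omega> u"
  shows "\<exists>v. ancient \<omega> v \<and> greedy_step \<omega> v = u"
proof (rule ccontr)
  assume no: "\<not> ?thesis"
  let ?D = "{u - (1, 1), u - (-1, 1)}"
  have "\<exists>n. \<forall>v. v \<in> perc_points \<omega> \<longrightarrow> anc \<omega> n v = d \<longrightarrow> greedy_step \<omega> d \<noteq> u" for d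
  proof (cases "greedy_step \<omega> d = u \<and> d \<in> perc_points \<omega>")
    case True
    then have "\<not> ancient \<omega> d" using no by blast
    then show ?thesis using True unfolding ancient_def by blast
  next
    case False
    then show ?thesis by (metis funpow_0)
  qed
  then obtain N where N: "\<And>d v. v \<in> perc_points \<omega> \<Longrightarrow> anc \<omega> (N d) v = d \<Longrightarrow> greedy_step \<omega> d \<noteq> u"
    by metis
  \<comment> \<open>\<open>N d\<close> is a generation in which the descendants of a daughter \<open>d\<close> have died out\<close>
  let ?n = "max (N (u - (1, 1))) (N (u - (-1, 1)))"
  obtain v where v: "v \<in> perc_points \<omega>" "anc \<omega> (Suc ?n) v = u"
    using assms unfolding ancient_def by blast
  let ?d = "anc \<omega> ?n v"
  have g: "greedy_step \<omega> ?d = u" using v(2) by simp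
  then have "?d = u - (1, 1) \<or> ?d = u - (-1, 1)"
    using greedy_step_cases[of \<omega> ?d] by (metis add_diff_cancel_right')
  then have "N ?d \<le> ?n" by (metis max.cobounded1 max.cobounded2)
  then have "anc \<omega> (N ?d) (anc \<omega> (?n - N ?d) v) = ?d"
    unfolding anc_add by simp
  then show False using N[OF greedy_orbit[OF v(1)]] g by metis
qed

text \<open>For \<open>s = (1, 1)\<close> and \<open>s = (-1, 1)\<close> these are the two ways in which an ancient vertex can send
  unit mass to its mother.\<close>

definition ancient_turning :: "vertex \<Rightarrow> (edge \<Rightarrow> bool) \<Rightarrow> vertex \<Rightarrow> bool" where
  "ancient_turning s \<omega> u \<longleftrightarrow> ancient \<omega> u \<and> greedy_step \<omega> u = u + s"

lemma covariant_ancient_turning: "covariant (ancient_turning s)"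
proof -
  have "greedy_step (translate t \<omega>) u = u + s \<longleftrightarrow> greedy_step \<omega> (u + t) = u + t + s"
    if "t \<in> lattice" for t \<omega> u
  proof -
    have "greedy_step (translate t \<omega>) u = u + s \<longleftrightarrow> greedy_step (translate t \<omega>) u + t = u + s + t"
      by simp
    also have "u + s + t = u + t + s" by (simp add: ac_simps)
    finally show ?thesis by (simp only: greedy_step_shift[OF that])
  qed
  then show ?thesis
    using covariant_ancient by (simp add: covariant_def ancient_turning_def)
qed

lemma measurable_ancient_turning: "Measurable.pred (percolation p) (\<lambda>\<omega>. ancient_turning s \<omega> u)"
  unfolding ancient_turning_def
  by (intro pred_intros_logic measurable_ancient measurable_greedy_step_eq)

lemma ancient_turning_right_left:
  "ancient \<omega> u \<longleftrightarrow> ancient_turning (1, 1) \<omega> u \<or> ancient_turning (-1, 1) \<omega> u"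
  using greedy_step_cases[of \<omega> u] by (auto simp: ancient_turning_def)

lemma ancient_turning_into:
  "ancient \<omega> u \<longleftrightarrow> ancient_turning (1, 1) \<omega> (u - (1, 1)) \<or> ancient_turning (-1, 1) \<omega> (u - (-1, 1))"
proof
  assume "ancient \<omega> u"
  then obtain v where v: "ancient \<omega> v" "greedy_step \<omega> v = u" using ancient_daughter by blast
  then show "ancient_turning (1, 1) \<omega> (u - (1, 1)) \<or> ancient_turning (-1, 1) \<omega> (u - (-1, 1))"
    using greedy_step_cases[of \<omega> v] unfolding ancient_turning_def by auto
next
  assume "ancient_turning (1, 1) \<omega> (u - (1, 1)) \<or> ancient_turning (-1, 1) \<omega> (u - (-1, 1))"
  then show "ancient \<omega> u"
    unfolding ancient_turning_def
    using ancient_greedy_step[of \<omega> "u - (1, 1)"] ancient_greedy_step[of \<omega> "u - (-1, 1)"] by auto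
qed

text \<open>Mass transport. Being ancient is the disjoint union of sending mass to the right and to the left,
  and also the union of receiving mass from the left and from the right. By invariance the pairs of
  events have the same probabilities, so the overlap of the second union is null.\<close>

lemma AE_not_two_ancient_daughters:
  "AE \<omega> in percolation p. \<forall>u\<in>lattice.
     \<not> (ancient_turning (1, 1) \<omega> (u - (1, 1)) \<and> ancient_turning (-1, 1) \<omega> (u - (-1, 1)))"
proof (rule AE_not_covariant)
  let ?M = "percolation p"
  interpret prob_space ?M by (rule prob_space_percolation)
  show "Measurable.pred ?M (\<lambda>\<omega>. ancient_turning (1, 1) \<omega> (u - (1, 1)) \<and>
          ancient_turning (-1, 1) \<omega> (u - (-1, 1)))" for u
    by (intro pred_intros_logic measurable_ancient_turning)
  fix u assume u: "u \<in> lattice"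
  define T where "T s v = {\<omega> \<in> space ?M. ancient_turning s \<omega> v}" for s v
  have T: "T s v \<in> sets ?M" for s v
    unfolding T_def by (rule pred_prob_event[OF measurable_ancient_turning])
  have stat: "prob (T s (u - r)) = prob (T s u)" if "r \<in> lattice" for s r
    unfolding T_def using lattice_add[OF that, of "u - r"] u
    by (intro prob_covariant[OF covariant_ancient_turning measurable_ancient_turning]) simp_all
  have "T (1, 1) u \<union> T (-1, 1) u = T (1, 1) (u - (1, 1)) \<union> T (-1, 1) (u - (-1, 1))"
    unfolding T_def using ancient_turning_right_left[of _ u] ancient_turning_into[of _ u] by blast
  moreover have "T (1, 1) u \<inter> T (-1, 1) u = {}"
    unfolding T_def ancient_turning_def by auto
  moreover have "prob (T (1, 1) u) = prob (T (1, 1) (u - (1, 1)))"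
    "prob (T (-1, 1) u) = prob (T (-1, 1) (u - (-1, 1)))"
    by (simp_all add: stat lattice_def)
  ultimately have "prob (T (1, 1) (u - (1, 1)) \<inter> T (-1, 1) (u - (-1, 1))) = 0"
    using measure_Un3[of "T (1, 1) (u - (1, 1))" ?M "T (-1, 1) (u - (-1, 1))"]
      measure_Un3[of "T (1, 1) u" ?M "T (-1, 1) u"] T
    by (simp add: fmeasurable_eq_sets)
  then show "prob {\<omega> \<in> space ?M. ancient_turning (1, 1) \<omega> (u - (1, 1)) \<and>
          ancient_turning (-1, 1) \<omega> (u - (-1, 1))} = 0"
    by (simp add: T_def Int_def conj_ac cong: conj_cong)
qed

text \<open>Just before two ancient vertices of a level coalesce, their paths are at two ancient daughters
  of one vertex.\<close>

lemma AE_no_ancient: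
  assumes "0 \<le> p" "p < 1"
  shows "AE \<omega> in percolation p. \<forall>u\<in>lattice. \<not> ancient \<omega> u"
proof (rule covariant_unique_on_levels[OF covariant_ancient measurable_ancient])
  show "AE \<omega> in percolation p. \<forall>u\<in>lattice. \<forall>v\<in>lattice. ancient \<omega> u \<longrightarrow> ancient \<omega> v \<longrightarrow>
          snd u = snd v \<longrightarrow> u = v"
    using AE_coalesce[OF assms] AE_not_two_ancient_daughters
  proof eventually_elim
    case (elim \<omega>)
    have anc_ancient: "ancient \<omega> (anc \<omega> n u)" if "ancient \<omega> u" for n u
      by (induction n) (simp_all add: that ancient_greedy_step)
    show ?case
    proof (intro ballI impI, rule ccontr)
      fix u v assume uv: "ancient \<omega> u" "ancient \<omega> v" "snd u = snd v" and ne: "u \<noteq> v"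
      have "coalesce \<omega> u v" using elim(1) uv unfolding ancient_def by blast
      then obtain n where n: "anc \<omega> n u \<noteq> anc \<omega> n v" "anc \<omega> (Suc n) u = anc \<omega> (Suc n) v"
        using first_meeting ne by blast
      let ?a = "anc \<omega> n u" and ?b = "anc \<omega> n v" and ?w = "anc \<omega> (Suc n) u"
      have ab: "ancient \<omega> ?a" "ancient \<omega> ?b" using uv anc_ancient by blast+
      have g: "greedy_step \<omega> ?a = ?w" "greedy_step \<omega> ?b = ?w" using n(2) by simp_all
      have "?a = ?w - (1, 1) \<and> ?b = ?w - (-1, 1) \<or> ?b = ?w - (1, 1) \<and> ?a = ?w - (-1, 1)"
        using greedy_step_cases[of \<omega> ?a] greedy_step_cases[of \<omega> ?b] g n(1)
        by (metis add_diff_cancel_right')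
      then have "ancient_turning (1, 1) \<omega> (?w - (1, 1)) \<and> ancient_turning (-1, 1) \<omega> (?w - (-1, 1))"
        using ab g unfolding ancient_turning_def by (metis diff_add_cancel)
      moreover have "?w \<in> lattice"
        using anc_ancient[OF uv(1), of "Suc n"] perc_points_lattice unfolding ancient_def by blast
      ultimately show False using elim(2) by blast
    qed
  qed
qed

text \<open>If generation \<open>N\<close> is empty, then so are all later ones, and each generation is finite because
  a path moves by one in each step.\<close>

lemma finite_branch_if_not_ancient:
  assumes "u \<in> perc_points \<omega>" "\<not> ancient \<omega> u"
  shows "finite (branch \<omega> u)"
proof -
  obtain N where N: "\<And>v. v \<in> perc_points \<omega> \<Longrightarrow> anc \<omega> N v \<noteq> u"
    using assms unfolding ancient_def by blast
  have "branch \<omega> u \<subseteq> (\<Union>n\<in>{..<N}. {fst u - int n..fst u + int n} \<times> {snd u - int n})"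
  proof
    fix v assume "v \<in> branch \<omega> u"
    then obtain n where v: "v \<in> perc_points \<omega>" "anc \<omega> n v = u"
      unfolding branch_def by (auto simp: mother_pow)
    have "n < N"
    proof (rule ccontr)
      assume "\<not> n < N"
      then have "anc \<omega> N (anc \<omega> (n - N) v) = u" using v(2) by (simp add: anc_add)
      then show False using N[OF greedy_orbit[OF v(1)]] by blast
    qed
    moreover have "v \<in> {fst u - int n..fst u + int n} \<times> {snd u - int n}"
      using fst_anc_bound[of n \<omega> v] snd_greedy[of n \<omega> v] v(2) by (cases v) auto
    ultimately show "v \<in> (\<Union>n\<in>{..<N}. {fst u - int n..fst u + int n} \<times> {snd u - int n})" by blast
  qed
  then show ?thesis by (rule finite_subset) auto
qed

section \<open>Younger sisters\<close>

definition last_on_level :: "(edge \<Rightarrow> bool) \<Rightarrow> vertex \<Rightarrow> bool" where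
  "last_on_level \<omega> u \<longleftrightarrow> u \<in> perc_points \<omega> \<and>
     (\<forall>v. v \<in> perc_points \<omega> \<longrightarrow> snd u = snd v \<longrightarrow> fst v \<le> fst u)"

lemma AE_no_last_on_level:
  "AE \<omega> in percolation p. \<forall>u\<in>lattice. \<not> last_on_level \<omega> u"
proof (rule covariant_unique_on_levels)
  show "covariant last_on_level"
    unfolding last_on_level_def[abs_def]
    by (intro covariant_conj covariant_perc_points covariant_all_vertices)
       (simp_all add: perc_points_shift)
  show "Measurable.pred (percolation p) (\<lambda>\<omega>. last_on_level \<omega> u)" for u
    unfolding last_on_level_def
    by (intro pred_intros_countable pred_intros_logic percolation_measurable; simp)
  have "u = v" if "last_on_level \<omega> u" "last_on_level \<omega> v" "snd u = snd v" for \<omega> u v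
  proof -
    have "fst u \<le> fst v" "fst v \<le> fst u" using that that(3)[symmetric] unfolding last_on_level_def by blast+
    then show ?thesis using that(3) by (simp add: prod_eq_iff)
  qed
  then show "AE \<omega> in percolation p. \<forall>u\<in>lattice. \<forall>v\<in>lattice. last_on_level \<omega> u \<longrightarrow>
      last_on_level \<omega> v \<longrightarrow> snd u = snd v \<longrightarrow> u = v"
    by simp
qed

text \<open>By order preservation the path from the right arrives at the meeting point by a step to the
  left, so the last ancestor of \<open>u\<close> before it is the older sister.\<close>

lemma younger_sister_if_coalesce:
  assumes u: "u \<in> perc_points \<omega>" and v: "v \<in> perc_points \<omega>"
    and "snd u = snd v" "fst u < fst v" "coalesce \<omega> u v"
  shows "\<exists>n s. younger_sister \<omega> s ((mother \<omega> ^^ n) u)"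
proof -
  obtain n where n: "anc \<omega> n u \<noteq> anc \<omega> n v" "anc \<omega> (Suc n) u = anc \<omega> (Suc n) v"
    using first_meeting assms by blast
  let ?a = "anc \<omega> n u" and ?b = "anc \<omega> n v" and ?w = "anc \<omega> (Suc n) u"
  have K: "?a \<in> perc_points \<omega>" "?b \<in> perc_points \<omega>" "?w \<in> perc_points \<omega>"
    using greedy_orbit u v by blast+
  have g: "greedy_step \<omega> ?a = ?w" "greedy_step \<omega> ?b = ?w" using n(2) by simp_all
  have "fst ?a \<le> fst ?b" using anc_mono[OF u v] assms by simp
  moreover have "?w = ?a + (1, 1) \<or> ?w = ?a + (-1, 1)" "?w = ?b + (1, 1) \<or> ?w = ?b + (-1, 1)"
    using greedy_step_cases[of \<omega> ?a] greedy_step_cases[of \<omega> ?b] g by metis+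
  ultimately have "?a = (fst ?w - 1, snd ?w - 1)" "?b = (fst ?w + 1, snd ?w - 1)"
    using n(1) by (auto simp: prod_eq_iff)
  moreover have "daughter \<omega> ?a ?w" "daughter \<omega> ?b ?w"
    unfolding daughter_def mother_greedy[OF K(1)] mother_greedy[OF K(2)] using K g by blast+
  ultimately have "younger_sister \<omega> ?b ?a"
    unfolding younger_sister_def by (metis prod.collapse)
  then show ?thesis using mother_pow[OF u, of n] by metis
qed

section \<open>Existence of percolation points\<close>

text \<open>This makes the set in the definition of \<^const>\<open>p_crit\<close> nonempty, so that its supremum is
  meaningful and not negative.\<close>

lemma theta_0: "theta 0 = 0"
proof -
  let ?M = "percolation 0" and ?N = "measure_pmf (bernoulli_pmf 0)"
  interpret prob_space ?M by (rule prob_space_percolation)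
  interpret E: product_prob_space "\<lambda>_. ?N" lattice_edges by unfold_locales
  have "True \<notin> set_pmf (bernoulli_pmf 0)" by (simp add: set_pmf_iff)
  then have "AE x in ?N. \<not> x" unfolding AE_measure_pmf_iff by metis
  then have closed: "AE \<omega> in ?M. \<not> \<omega> e" if "e \<in> lattice_edges" for e
    unfolding percolation_def using that by (intro E.AE_component)
  have "AE \<omega> in ?M. \<forall>e\<in>lattice_edges. \<not> \<omega> e"
    using closed by (simp add: AE_ball_countable)
  then have "AE \<omega> in ?M. \<omega> \<notin> {\<omega> \<in> space ?M. infinite (cluster \<omega> (0, 0))}"
  proof eventually_elim
    case (elim \<omega>)
    then have "open_edges \<omega> = {}" by (auto simp: open_edges_def)
    then have "cluster \<omega> (0, 0) \<subseteq> {(0, 0)}" by (auto simp: cluster_def reaches_def)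
    then show ?case by (auto dest: finite_subset)
  qed
  then show ?thesis
    unfolding theta_def using prob_eq_0[OF measurable_infinite_cluster] by blast
qed

lemma p_crit_nonneg: "0 \<le> p_crit"
  unfolding p_crit_def using theta_0 by (intro cSup_upper bdd_aboveI[of _ 1]) auto

lemma theta_pos:
  assumes "p_crit < p" "p < 1"
  shows "0 < theta p"
proof -
  have "theta p \<noteq> 0"
  proof
    assume "theta p = 0"
    then have "p \<le> p_crit"
      unfolding p_crit_def using assms p_crit_nonneg by (intro cSup_upper bdd_aboveI[of _ 1]) auto
    then show False using assms by simp
  qed
  then show ?thesis by (simp add: theta_def zero_less_measure_iff)
qed

text \<open>A percolation point sends its path up to every higher level, so the lower edges cannot matter.\<close>

lemma perc_points_upper_nonempty:
  "perc_points (keep (upper_edges h) \<omega>) \<noteq> {} \<longleftrightarrow> perc_points \<omega> \<noteq> {}"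
proof -
  have "\<exists>u\<in>perc_points \<omega>. h \<le> snd u" if "v \<in> perc_points \<omega>" for v \<omega>
    using greedy_orbit[OF that, of "nat (h - snd v)"] snd_greedy[of "nat (h - snd v)" \<omega> v]
    by (intro bexI) auto
  then show ?thesis using perc_points_keep by (metis all_not_in_conv)
qed

lemma AE_perc_points_nonempty:
  assumes "0 < theta p"
  shows "AE \<omega> in percolation p. perc_points \<omega> \<noteq> {}"
proof -
  let ?M = "percolation p"
  interpret prob_space ?M by (rule prob_space_percolation)
  let ?E = "{\<omega> \<in> space ?M. perc_points \<omega> \<noteq> {}}"
  define L where "L i = {e \<in> lattice_edges. snd (fst e) = int i}" for i
  have meas: "Measurable.pred ?M (\<lambda>\<omega>. perc_points \<omega> \<noteq> {})"
  proof -
    have "Measurable.pred ?M (\<lambda>\<omega>. \<exists>u. u \<in> perc_points \<omega>)"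
      by (intro pred_intros_countable measurable_perc_points)
    then show ?thesis by (simp only: ex_in_conv)
  qed
  have "prob ?E = 0 \<or> prob ?E = 1"
  proof (rule kolmogorov_0_1_law[where A = "\<lambda>i. edge_events p (L i)"])
    show "sigma_algebra (space ?M) (edge_events p (L i))" for i
      by (rule sigma_algebra_edge_events)
    show "indep_sets (\<lambda>i. edge_events p (L i)) UNIV"
      by (rule indep_edge_events) (auto simp: L_def disjoint_family_on_def)
    show "?E \<in> tail_events (\<lambda>i. edge_events p (L i))"
      unfolding tail_events_def
    proof
      fix n
      have "?E \<in> edge_events p (upper_edges (int n))"
        by (rule edge_eventsI[OF _ meas perc_points_upper_nonempty]) (auto simp: upper_edges_def)
      moreover have "edge_events p (upper_edges (int n)) \<subseteq>
          sigma_sets (space ?M) (\<Union>i\<in>{n..}. edge_events p (L i))"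
        unfolding edge_events_def[of p "upper_edges (int n)"]
      proof (rule sigma_sets_subseteq, rule UN_least)
        fix e assume "e \<in> upper_edges (int n)"
        then have e: "e \<in> L (nat (snd (fst e)))" "nat (snd (fst e)) \<in> {n..}"
          by (auto simp: upper_edges_def L_def)
        have "edge_generators p e \<subseteq> edge_events p (L (nat (snd (fst e))))"
          unfolding edge_events_def using e(1) by (auto intro: sigma_sets.Basic)
        then show "edge_generators p e \<subseteq> (\<Union>i\<in>{n..}. edge_events p (L i))" using e(2) by blast
      qed
      ultimately show "?E \<in> sigma_sets (space ?M) (\<Union>i\<in>{n..}. edge_events p (L i))" by blast
    qed
  qed
  moreover have "theta p \<le> prob ?E"
    unfolding theta_def
    by (rule finite_measure_mono[OF _ pred_prob_event[OF meas]])
       (auto simp: perc_points_def lattice_def intro!: exI[of _ 0])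
  ultimately have "prob ?E = 1" using assms by linarith
  then have "AE \<omega> in ?M. \<omega> \<in> ?E" using AE_in_set_eq_1 pred_prob_event[OF meas] by blast
  then show ?thesis by eventually_elim simp
qed

section \<open>The three properties of the graph\<close>

lemma graph_components_ex1:
  assumes "perc_points \<omega> \<noteq> {}"
    and coalesce: "\<And>u v. u \<in> perc_points \<omega> \<Longrightarrow> v \<in> perc_points \<omega> \<Longrightarrow> snd u = snd v \<Longrightarrow> coalesce \<omega> u v"
  shows "\<exists>!C. C \<in> graph_components \<omega>"
proof -
  have low: "\<exists>n m. anc \<omega> n u = anc \<omega> m v"
    if u: "u \<in> perc_points \<omega>" and v: "v \<in> perc_points \<omega>" and le: "snd u \<le> snd v" for u v
  proof -
    let ?k = "nat (snd v - snd u)"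
    have "coalesce \<omega> (anc \<omega> ?k u) v"
      using le by (intro coalesce greedy_orbit u v) (simp add: snd_greedy)
    then obtain n where "anc \<omega> n (anc \<omega> ?k u) = anc \<omega> n v" unfolding coalesce_def by blast
    then show ?thesis unfolding anc_add by blast
  qed
  have "connected_rel \<omega> = perc_points \<omega> \<times> perc_points \<omega>"
  proof -
    have "(\<exists>n m. (mother \<omega> ^^ n) u = (mother \<omega> ^^ m) v)"
      if "u \<in> perc_points \<omega>" "v \<in> perc_points \<omega>" for u v
      using low[of u v] low[of v u] that mother_pow[of _ \<omega>] linear[of "snd u" "snd v"] by metis
    then show ?thesis unfolding connected_rel_def by auto
  qed
  then have "graph_components \<omega> = {perc_points \<omega>}"
    using assms(1) unfolding graph_components_def quotient_def by auto
  then show ?thesis by simp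
qed

theorem theorem1p1:
  fixes p :: real
  assumes "p_crit < p" and "p < 1"
  shows "AE \<omega> in percolation p.
           (\<exists>!C. C \<in> graph_components \<omega>) \<and>
           (\<forall>u\<in>perc_points \<omega>. finite (branch \<omega> u)) \<and>
           (\<forall>u\<in>perc_points \<omega>. \<exists>n s. younger_sister \<omega> s ((mother \<omega> ^^ n) u))"
proof -
  have p: "0 \<le> p" "p < 1" using assms p_crit_nonneg by auto
  show ?thesis
    using AE_perc_points_nonempty[OF theta_pos[OF assms]] AE_coalesce[OF p] AE_no_ancient[OF p]
      AE_no_last_on_level
  proof eventually_elim
    case (elim \<omega>)
    have "\<exists>!C. C \<in> graph_components \<omega>"
      using elim(1,2) by (intro graph_components_ex1) auto
    moreover have "finite (branch \<omega> u)" if "u \<in> perc_points \<omega>" for u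
      using elim(3) perc_points_lattice[OF that] by (intro finite_branch_if_not_ancient that) blast
    moreover have "\<exists>n s. younger_sister \<omega> s ((mother \<omega> ^^ n) u)" if u: "u \<in> perc_points \<omega>" for u
    proof -
      have "\<not> last_on_level \<omega> u" using elim(4) perc_points_lattice[OF u] by blast
      then obtain v where v: "v \<in> perc_points \<omega>" "snd u = snd v" "fst u < fst v"
        using u unfolding last_on_level_def by force
      then have "coalesce \<omega> u v" using elim(2) u by blast
      then show ?thesis by (rule younger_sister_if_coalesce[OF u v])
    qed
    ultimately show ?case by blast
  qed
qed

end
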